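(* Let $(W,S)$ be a finite Coxeter system with length function $l$ and longest element $w_0$. For any $J \subseteq S$, let $W_J$ be the standard parabolic subgroup generated by $J$ and let $X_J$ be the set of distinguished left coset representatives of $W_J$ in $W$. Then $$\sum_{w \in X_J} (-1)^{l(w)} = \left|\{\, w \in X_J : w_0 w W_J = w W_J \,\}\right|.$$
   Context: A finite Coxeter system $(W,S)$ consists of a finite Coxeter group $W$ with its set $S$ of simple reflections; $l : W \to \mathbb{Z}_{\ge 0}$ is the length function with respect to $S$, and $w_0$ is the unique element of $W$ of maximal length. For $J \subseteq S$, $W_J = \langle J \rangle$ is the standard parabolic subgroup. The set of distinguished left coset representatives is $X_J = \{ w \in W : l(ws) > l(w) \text{ for all } s \in J \}$; it contains exactly one element of each left coset $wW_J$, namely the unique element of minimal length in that coset. *)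

theory Defs
  imports "HOL-Algebra.Algebra"
begin

definition word_prod :: "('a, 'b) monoid_scheme \<Rightarrow> 'a list \<Rightarrow> 'a" where
  "word_prod W u = foldr (\<lambda>x y. x \<otimes>\<^bsub>W\<^esub> y) u \<one>\<^bsub>W\<^esub>"

text \<open>The entry \<open>m s t = 0\<close> encodes \<open>m(s,t) = \<infinity>\<close>, i.e. no relation between \<open>s\<close> and \<open>t\<close>.\<close>

definition coxeter_matrix :: "'a set \<Rightarrow> ('a \<Rightarrow> 'a \<Rightarrow> nat) \<Rightarrow> bool" where
  "coxeter_matrix S m \<longleftrightarrow>
     (\<forall>s\<in>S. m s s = 1) \<and>
     (\<forall>s\<in>S. \<forall>t\<in>S. m s t = m t s) \<and>
     (\<forall>s\<in>S. \<forall>t\<in>S. s \<noteq> t \<longrightarrow> m s t \<noteq> 1)"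

text \<open>
  Equality of words in the group presented by generators \<open>S\<close> and relators \<open>(s t)\<^sup>m\<^sup>(\<^sup>s\<^sup>,\<^sup>t\<^sup>)\<close>:
  the congruence on the free monoid over \<open>S\<close> generated by these relators. Because
  \<open>m s s = 1\<close> makes \<open>s s\<close> a relator, every generator is its own inverse, so the monoid
  with this presentation is the group with this presentation and no letters for formal
  inverses are needed.
\<close>

inductive coxeter_equiv :: "'a set \<Rightarrow> ('a \<Rightarrow> 'a \<Rightarrow> nat) \<Rightarrow> 'a list \<Rightarrow> 'a list \<Rightarrow> bool"
  for S :: "'a set" and m :: "'a \<Rightarrow> 'a \<Rightarrow> nat" where
  relator: "\<lbrakk>u \<in> lists S; v \<in> lists S; s \<in> S; t \<in> S\<rbrakk> \<Longrightarrow>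
     coxeter_equiv S m (u @ concat (replicate (m s t) [s, t]) @ v) (u @ v)"
| refl: "u \<in> lists S \<Longrightarrow> coxeter_equiv S m u u"
| sym: "coxeter_equiv S m u v \<Longrightarrow> coxeter_equiv S m v u"
| trans: "\<lbrakk>coxeter_equiv S m u v; coxeter_equiv S m v w\<rbrakk> \<Longrightarrow> coxeter_equiv S m u w"

text \<open>\<open>W = \<langle>S | (s t)\<^sup>m\<^sup>(\<^sup>s\<^sup>,\<^sup>t\<^sup>) = 1\<rangle>\<close> for some Coxeter matrix \<open>m\<close>.\<close>

definition coxeter_system :: "('a, 'b) monoid_scheme \<Rightarrow> 'a set \<Rightarrow> bool" where
  "coxeter_system W S \<longleftrightarrow>
     group W \<and> S \<subseteq> carrier W \<and> generate W S = carrier W \<and>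
     (\<exists>m. coxeter_matrix S m \<and>
        (\<forall>u\<in>lists S. \<forall>v\<in>lists S.
           word_prod W u = word_prod W v \<longleftrightarrow> coxeter_equiv S m u v))"

definition finite_coxeter_system :: "('a, 'b) monoid_scheme \<Rightarrow> 'a set \<Rightarrow> bool" where
  "finite_coxeter_system W S \<longleftrightarrow> coxeter_system W S \<and> finite (carrier W)"

definition cox_length :: "('a, 'b) monoid_scheme \<Rightarrow> 'a set \<Rightarrow> 'a \<Rightarrow> nat" where
  "cox_length W S w = (LEAST n. \<exists>u\<in>lists S. length u = n \<and> word_prod W u = w)"

definition longest_element :: "('a, 'b) monoid_scheme \<Rightarrow> 'a set \<Rightarrow> 'a" where
  "longest_element W S =
     (THE w. w \<in> carrier W \<and> (\<forall>v\<in>carrier W. cox_length W S v \<le> cox_length W S w))"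

definition left_coset_reps :: "('a, 'b) monoid_scheme \<Rightarrow> 'a set \<Rightarrow> 'a set \<Rightarrow> 'a set" where
  "left_coset_reps W S J =
     {w \<in> carrier W. \<forall>s\<in>J. cox_length W S (w \<otimes>\<^bsub>W\<^esub> s) > cox_length W S w}"

end

theory Submission
  imports Defs
begin

text \<open>
  Both sides of the identity are the trace of one operator. Let \<open>W\<close> act on \<open>V = \<real>\<^sup>S\<close> by its
  geometric representation. There is a linear form \<open>\<phi>\<close> on \<open>V\<close> that is positive on all positive
  roots and satisfies \<open>\<phi> \<circ> w0 = -\<phi>\<close>. The points \<open>\<phi> \<circ> x\<close> of the dual space, for \<open>x \<in> W\<close>, are
  pairwise different, so a real function on \<open>W\<close> is a function on a regular orbit in the dual of
  \<open>V\<close>, and it can be written as a polynomial in the linear functions \<open>x \<mapsto> \<phi> (x v)\<close>. This filters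
  the functions on \<open>W\<close> by degree. Left translation \<open>(\<tau> f) x = f (w0 x)\<close> is composition with the
  antipodal map, so \<open>\<tau>\<close> acts on the graded piece of degree \<open>k\<close> as \<open>(-1)\<^sup>k\<close>
  (\<open>w0_on_graded_piece\<close>). Now restrict \<open>\<tau>\<close> to the functions that are constant on the left cosets
  of \<open>W\<^sub>J\<close>. In the basis of indicator functions of cosets, \<open>\<tau>\<close> is a permutation matrix whose
  trace is the number of cosets fixed by \<open>w0\<close>. On the other hand the graded piece of degree \<open>k\<close>
  has as dimension the number of \<open>w \<in> X\<^sub>J\<close> with \<open>l(w) = k\<close>, so that the trace is
  \<open>\<Sum> (-1)\<^sup>l\<^sup>(\<^sup>w\<^sup>)\<close> over \<open>w \<in> X\<^sub>J\<close>.

  The dimension count uses the divided differences \<open>(\<partial>\<^sub>s f) x = (f x - f (x s)) / \<phi> (x \<alpha>\<^sub>s)\<close>.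
  They lower the degree, and a function has degree less than \<open>k\<close> if and only if every product of
  \<open>k\<close> divided differences kills it; this is taken as the definition of the filtration
  (\<open>deg_less\<close>). Choose a reduced word for each \<open>w\<close> and let \<open>L\<^sub>w f\<close> be the value at \<open>1\<close> of the
  corresponding product of divided differences applied to \<open>f\<close>. By definition \<open>L\<^sub>w\<close> vanishes on
  functions of degree less than \<open>l(w)\<close>. The heart of the proof is the converse
  \<open>deg_less_criterion\<close>: if \<open>L\<^sub>w f = 0\<close> for all \<open>w\<close> with \<open>l(w) \<ge> k\<close>, then \<open>f\<close> has degree less
  than \<open>k\<close>. It follows by pairing the \<open>L\<^sub>w\<close> with the functions obtained from the delta function
  at \<open>1\<close> by products of divided differences, once the following is known about \<open>N = l(w0)\<close>: more
  than \<open>N\<close> divided differences kill everything (\<open>deg_less_top\<close>), and a product of exactly \<open>N\<close> of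
  them, applied to the delta function at \<open>1\<close>, is nonzero at \<open>1\<close> precisely if their letters form
  a reduced word of \<open>w0\<close> (\<open>top_coefficient_nonzero_iff\<close>).

  If the reduced words of the elements outside \<open>X\<^sub>J\<close> are chosen to end in a letter of \<open>J\<close>, then
  \<open>L\<^sub>w\<close> vanishes on the functions constant on cosets for \<open>w \<notin> X\<^sub>J\<close>, while the \<open>L\<^sub>w\<close> with
  \<open>w \<in> X\<^sub>J\<close> form a basis of the dual of that space, and the trace of \<open>\<tau>\<close> can be read off from
  it.
\<close>

section \<open>Triangular linear systems\<close>

lemma triangular_solve:
  fixes M :: "'b \<Rightarrow> 'b \<Rightarrow> real" and r :: "'b \<Rightarrow> nat"
  assumes "finite A"
    and "\<And>i. i \<in> A \<Longrightarrow> M i i \<noteq> 0"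
    and "\<And>i j. \<lbrakk>i \<in> A; j \<in> A; M i j \<noteq> 0\<rbrakk> \<Longrightarrow> j = i \<or> r j < r i"
  shows "\<exists>c. \<forall>i\<in>A. (\<Sum>j\<in>A. M i j * c j) = b i"
  using assms
proof (induction rule: finite_ranking_induct[where f = r])
  case empty
  show ?case by simp
next
  case (insert x A)
  show ?case
  proof (cases "x \<in> A")
    case True
    then show ?thesis using insert by (simp add: insert_absorb)
  next
    case False
    obtain c where c: "\<forall>i\<in>A. (\<Sum>j\<in>A. M i j * c j) = b i"
      using insert.IH insert.prems by (metis insertCI)
    define c' where "c' = c(x := (b x - (\<Sum>j\<in>A. M x j * c j)) / M x x)"
    have old: "(\<Sum>j\<in>A. M i j * c' j) = (\<Sum>j\<in>A. M i j * c j)" for i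
      by (rule sum.cong) (use False in \<open>auto simp: c'_def\<close>)
    have "M i x = 0" if "i \<in> A" for i
      using insert.prems(2)[of i x] insert.hyps(2)[OF that] that False by force
    then show ?thesis
      using c old insert.hyps(1) insert.prems(1)[of x] False
      by (intro exI[of _ c']) (auto simp: c'_def)
  qed
qed

text \<open>
  The matrix of Coxeter exponents is fixed along with the group, because the geometric
  representation is built from it.
\<close>

locale finite_coxeter = group W for W (structure) +
  fixes S :: "'a set" and m :: "'a \<Rightarrow> 'a \<Rightarrow> nat"
  assumes S_sub: "S \<subseteq> carrier W"
    and gen: "generate W S = carrier W"
    and mat: "coxeter_matrix S m"
    and pres: "\<lbrakk>u \<in> lists S; v \<in> lists S\<rbrakk> \<Longrightarrow>
      word_prod W u = word_prod W v \<longleftrightarrow> coxeter_equiv S m u v"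
    and fin: "finite (carrier W)"
begin

abbreviation wp where "wp \<equiv> word_prod W"
abbreviation len where "len \<equiv> cox_length W S"

section \<open>Words and length\<close>

lemma finite_S: "finite S" using fin S_sub by (rule rev_finite_subset)

lemma S_carrier [simp]: "s \<in> S \<Longrightarrow> s \<in> carrier W" using S_sub by auto

lemma m_diag: "s \<in> S \<Longrightarrow> m s s = 1" using mat by (auto simp: coxeter_matrix_def)

lemma m_sym: "\<lbrakk>s \<in> S; t \<in> S\<rbrakk> \<Longrightarrow> m s t = m t s" using mat by (auto simp: coxeter_matrix_def)

lemma m_ne_1: "\<lbrakk>s \<in> S; t \<in> S; s \<noteq> t\<rbrakk> \<Longrightarrow> m s t \<noteq> 1" using mat by (auto simp: coxeter_matrix_def)

lemma wp_Nil [simp]: "wp [] = \<one>" by (simp add: word_prod_def)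

lemma wp_Cons [simp]: "wp (s # u) = s \<otimes> wp u" by (simp add: word_prod_def)

lemma wp_closed [simp]: "set u \<subseteq> S \<Longrightarrow> wp u \<in> carrier W"
  by (induction u) auto

lemma wp_append [simp]: "set u \<subseteq> S \<Longrightarrow> set v \<subseteq> S \<Longrightarrow> wp (u @ v) = wp u \<otimes> wp v"
  by (induction u) (auto simp: m_assoc)

lemma wp_relator:
  assumes "s \<in> S" "t \<in> S"
  shows "wp (concat (replicate (m s t) [s, t])) = \<one>"
proof -
  let ?u = "concat (replicate (m s t) [s, t])"
  have "coxeter_equiv S m ([] @ concat (replicate (m s t) [s, t]) @ []) ([] @ [])"
    by (rule coxeter_equiv.relator) (use assms in auto)
  moreover have "?u \<in> lists S" using assms by (auto split: if_splits)
  ultimately show ?thesis using pres[of ?u "[]"] by simp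
qed

lemma gen_square [simp]: "s \<in> S \<Longrightarrow> s \<otimes> s = \<one>"
  using wp_relator[of s s] by (simp add: m_diag)

lemma gen_inv [simp]: "s \<in> S \<Longrightarrow> inv s = s"
  by (simp add: inv_equality)

lemma mult_gen_gen [simp]: "\<lbrakk>w \<in> carrier W; s \<in> S\<rbrakk> \<Longrightarrow> w \<otimes> s \<otimes> s = w"
  by (simp add: m_assoc)

lemma gen_gen_mult [simp]: "\<lbrakk>w \<in> carrier W; s \<in> S\<rbrakk> \<Longrightarrow> s \<otimes> (s \<otimes> w) = w"
  by (simp flip: m_assoc)

lemma wp_rev: "set u \<subseteq> S \<Longrightarrow> wp (rev u) = inv (wp u)"
  by (induction u) (auto simp: inv_mult_group)

lemma generate_words:
  assumes "J \<subseteq> S" "w \<in> generate W J"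
  shows "\<exists>u. set u \<subseteq> J \<and> wp u = w"
  using assms(2)
proof induction
  case one
  show ?case by (intro exI[of _ "[]"]) auto
next
  case (incl h)
  then show ?case using assms(1) by (intro exI[of _ "[h]"]) auto
next
  case (inv h)
  then have "h \<in> S" using assms(1) by auto
  then show ?case using inv by (intro exI[of _ "[h]"]) auto
next
  case (eng h1 h2)
  then obtain u v where u: "set u \<subseteq> J" "wp u = h1" and v: "set v \<subseteq> J" "wp v = h2" by auto
  have "set u \<subseteq> S" "set v \<subseteq> S" using u v assms(1) by auto
  then show ?case using u v by (intro exI[of _ "u @ v"]) auto
qed

lemma ex_reduced_word:
  assumes "w \<in> carrier W"
  obtains u where "set u \<subseteq> S" "wp u = w" "length u = len w"
proof -
  have "\<exists>n. \<exists>u\<in>lists S. length u = n \<and> wp u = w"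
    using generate_words[of S w] gen assms by (auto simp: lists_eq_set)
  from LeastI_ex[OF this] obtain u where "u \<in> lists S" "wp u = w" "length u = len w"
    unfolding cox_length_def by blast
  then show ?thesis by (intro that[of u]) auto
qed

lemma len_wp_le: "set u \<subseteq> S \<Longrightarrow> len (wp u) \<le> length u"
  unfolding cox_length_def by (rule Least_le) (auto simp: lists_eq_set)

lemma len_one [simp]: "len \<one> = 0"
  using len_wp_le[of "[]"] by simp

lemma len_0_iff: "w \<in> carrier W \<Longrightarrow> len w = 0 \<longleftrightarrow> w = \<one>"
  by (metis ex_reduced_word len_one length_0_conv wp_Nil)

lemma len_mult_le:
  assumes "x \<in> carrier W" "y \<in> carrier W"
  shows "len (x \<otimes> y) \<le> len x + len y"
proof -
  obtain u v where "set u \<subseteq> S" "wp u = x" "length u = len x" "set v \<subseteq> S" "wp v = y" "length v = len y"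
    using assms ex_reduced_word[of x] ex_reduced_word[of y] by metis
  then show ?thesis using len_wp_le[of "u @ v"] by auto
qed

lemma len_gen_le: "s \<in> S \<Longrightarrow> len s \<le> 1"
  using len_wp_le[of "[s]"] by simp

lemma len_mult_gen_le: "\<lbrakk>w \<in> carrier W; s \<in> S\<rbrakk> \<Longrightarrow> len (w \<otimes> s) \<le> Suc (len w)"
  using len_mult_le[of w s] len_gen_le[of s] by simp

lemma len_inv_le: assumes "w \<in> carrier W" shows "len (inv w) \<le> len w"
proof -
  obtain u where u: "set u \<subseteq> S" "wp u = w" "length u = len w" using assms ex_reduced_word by blast
  then have "set (rev u) \<subseteq> S" by auto
  with u show ?thesis using len_wp_le[of "rev u"] wp_rev[of u] by simp
qed

lemma len_inv [simp]: "w \<in> carrier W \<Longrightarrow> len (inv w) = len w"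
  using len_inv_le[of w] len_inv_le[of "inv w"] by simp

lemma coxeter_equiv_parity: "coxeter_equiv S m u v \<Longrightarrow> even (length u) = even (length v)"
proof (induction rule: coxeter_equiv.induct)
  case (relator u v s t)
  have "length (concat (replicate n [s, t])) = 2 * n" for n by (induction n) auto
  then show ?case by simp
qed auto

text \<open>
  Every relator has even length, so the parity of the length of a word depends only on the
  element. This is what keeps right multiplication by a generator from preserving the length.
\<close>

lemma len_parity:
  assumes "set u \<subseteq> S"
  shows "even (len (wp u)) = even (length u)"
proof -
  obtain v where v: "set v \<subseteq> S" "wp v = wp u" "length v = len (wp u)"
    using ex_reduced_word[of "wp u"] assms by auto
  then have "coxeter_equiv S m v u" using pres[of v u] assms by (simp add: lists_eq_set)
  then show ?thesis using coxeter_equiv_parity v(3) by metis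
qed

lemma len_mult_gen_neq:
  assumes "w \<in> carrier W" "s \<in> S"
  shows "len (w \<otimes> s) \<noteq> len w"
proof -
  obtain u where u: "set u \<subseteq> S" "wp u = w" "length u = len w" using assms ex_reduced_word by blast
  show ?thesis using len_parity[of "u @ [s]"] len_parity[of u] u assms by auto
qed

lemma len_mult_gen_cases:
  assumes "w \<in> carrier W" "s \<in> S"
  shows "len (w \<otimes> s) = Suc (len w) \<or> Suc (len (w \<otimes> s)) = len w"
  using len_mult_gen_neq[OF assms] len_mult_gen_le[OF assms] len_mult_gen_le[of "w \<otimes> s" s] assms
  by auto

lemma ex_descent:
  assumes "w \<in> carrier W" "w \<noteq> \<one>"
  obtains s where "s \<in> S" "len (w \<otimes> s) < len w"
proof -
  obtain u where u: "set u \<subseteq> S" "wp u = w" "length u = len w" using assms ex_reduced_word by blast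
  have "u \<noteq> []" using u assms by auto
  then obtain v s where vs: "u = v @ [s]" by (metis rev_exhaust)
  then have "s \<in> S" "set v \<subseteq> S" using u by auto
  moreover from this have "w \<otimes> s = wp v" using u vs by auto
  moreover have "len (wp v) < len w" using len_wp_le[of v] u vs by auto
  ultimately show ?thesis using that by metis
qed

section \<open>The geometric representation\<close>

text \<open>
  The value \<open>1\<close> for the exponent \<open>0\<close>, which stands for \<open>\<infinity>\<close>, is the limit of \<open>cos (\<pi> / n)\<close>.
\<close>

definition cos_m :: "'a \<Rightarrow> 'a \<Rightarrow> real" where
  "cos_m s t = (if m s t = 0 then 1 else cos (pi / m s t))"

text \<open>
  The value \<open>B(\<alpha>\<^sub>s, v)\<close> of the invariant bilinear form, for a vector given by its coordinates in
  the basis of simple roots.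
\<close>

definition pair :: "'a \<Rightarrow> ('a \<Rightarrow> real) \<Rightarrow> real" where
  "pair s v = (\<Sum>t\<in>S. - cos_m s t * v t)"

definition form :: "('a \<Rightarrow> real) \<Rightarrow> ('a \<Rightarrow> real) \<Rightarrow> real" where
  "form u v = (\<Sum>s\<in>S. u s * pair s v)"

definition simple_root :: "'a \<Rightarrow> 'a \<Rightarrow> real" where
  "simple_root s = (\<lambda>t. if t = s then 1 else 0)"

definition reflect :: "'a \<Rightarrow> ('a \<Rightarrow> real) \<Rightarrow> 'a \<Rightarrow> real" where
  "reflect s v = (\<lambda>t. v t - 2 * pair s v * simple_root s t)"

definition act_word :: "'a list \<Rightarrow> ('a \<Rightarrow> real) \<Rightarrow> 'a \<Rightarrow> real" where
  "act_word u = foldr reflect u"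

lemma act_word_simps [simp]:
  "act_word [] v = v" "act_word (s # u) v = reflect s (act_word u v)"
  "act_word (u @ u') v = act_word u (act_word u' v)"
  by (simp_all add: act_word_def)

lemma cos_m_diag [simp]: "s \<in> S \<Longrightarrow> cos_m s s = -1"
  by (simp add: cos_m_def m_diag)

lemma cos_m_sym: "\<lbrakk>s \<in> S; t \<in> S\<rbrakk> \<Longrightarrow> cos_m s t = cos_m t s"
  by (simp add: cos_m_def m_sym)

lemma pair_root: "t \<in> S \<Longrightarrow> pair s (simple_root t) = - cos_m s t"
  using finite_S by (simp add: pair_def simple_root_def if_distrib[of "\<lambda>x. _ * x"] sum.delta cong: if_cong)

lemma pair_add: "pair s (\<lambda>t. u t + v t) = pair s u + pair s v"
  by (simp add: pair_def algebra_simps sum_subtractf sum_negf sum.distrib)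

lemma pair_scale: "pair s (\<lambda>t. a * v t) = a * pair s v"
  by (simp add: pair_def sum_distrib_left algebra_simps)

lemma pair_diff: "pair s (\<lambda>t. u t - v t) = pair s u - pair s v"
  using pair_add[of s u "\<lambda>t. (-1) * v t"] pair_scale[of s "-1" v] by simp

lemma pair_reflect: "s \<in> S \<Longrightarrow> pair r (reflect s v) = pair r v + 2 * cos_m r s * pair s v"
  by (simp add: reflect_def pair_diff pair_scale pair_root)

lemma reflect_reflect: "s \<in> S \<Longrightarrow> reflect s (reflect s v) = v"
  by (rule ext) (simp add: reflect_def[of s "reflect s v"] pair_reflect, simp add: reflect_def)

lemma reflect_lin: "reflect s (\<lambda>t. a * v t + b * u t) = (\<lambda>t. a * reflect s v t + b * reflect s u t)"
proof -
  have "pair s (\<lambda>t. a * v t + b * u t) = a * pair s v + b * pair s u"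
    by (simp add: pair_add pair_scale)
  then show ?thesis by (simp add: reflect_def algebra_simps)
qed

lemma act_word_lin:
  "act_word w (\<lambda>t. a * v t + b * u t) = (\<lambda>t. a * act_word w v t + b * act_word w u t)"
  by (induction w) (simp_all add: reflect_lin)

lemma act_word_zero: "act_word w (\<lambda>t. 0) = (\<lambda>t. 0)"
  using act_word_lin[of w 0 "\<lambda>t. 0" 0 "\<lambda>t. 0"] by simp

lemma act_word_sum:
  assumes "finite I"
  shows "act_word w (\<lambda>t. \<Sum>i\<in>I. c i * v i t) = (\<lambda>t. \<Sum>i\<in>I. c i * act_word w (v i) t)"
  using assms
proof induction
  case empty
  then show ?case by (simp add: act_word_zero)
next
  case (insert i I)
  then show ?case
    using act_word_lin[of w "c i" "v i" 1 "\<lambda>t. \<Sum>i\<in>I. c i * v i t"] by simp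
qed

lemma reflect_root:
  assumes "s \<in> S" "t \<in> S"
  shows "reflect s (simple_root t) = (\<lambda>r. simple_root t r + 2 * cos_m s t * simple_root s r)"
  using assms by (simp add: reflect_def pair_root)

text \<open>
  These are the values at \<open>cos (\<pi> / m)\<close> of the Chebyshev polynomials \<open>U\<^sub>k\<^sub>-\<^sub>1\<close> of the second
  kind, with their limits for \<open>m = \<infinity>\<close>. They are the coordinates of the roots of the dihedral
  group generated by \<open>s\<close> and \<open>t\<close>.
\<close>

definition cheb_U :: "'a \<Rightarrow> 'a \<Rightarrow> nat \<Rightarrow> real" where
  "cheb_U s t k = (if m s t = 0 then real k else sin (k * (pi / m s t)) / sin (pi / m s t))"

lemma m_ge_2:
  assumes "s \<in> S" "t \<in> S" "s \<noteq> t" "m s t \<noteq> 0"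
  shows "m s t \<ge> 2"
  using m_ne_1[OF assms(1-3)] assms(4) by linarith

lemma sin_m_pos:
  assumes "s \<in> S" "t \<in> S" "s \<noteq> t" "m s t \<noteq> 0"
  shows "sin (pi / m s t) > 0"
  using m_ge_2[OF assms] by (intro sin_gt_zero) (auto simp: field_simps)

context
  fixes s t
  assumes st: "s \<in> S" "t \<in> S" "s \<noteq> t"
begin

lemma cheb_U_0: "cheb_U s t 0 = 0" by (simp add: cheb_U_def)

lemma cheb_U_1: "cheb_U s t (Suc 0) = 1"
proof (cases "m s t = 0")
  case False
  then show ?thesis using sin_m_pos[OF st False] by (simp add: cheb_U_def)
qed (simp add: cheb_U_def)

lemma cheb_U_rec: "cheb_U s t (Suc (Suc k)) = 2 * cos_m s t * cheb_U s t (Suc k) - cheb_U s t k"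
proof (cases "m s t = 0")
  case True
  then show ?thesis by (simp add: cheb_U_def cos_m_def)
next
  case False
  define \<theta> where "\<theta> = pi / m s t"
  have "sin (real (Suc (Suc k)) * \<theta>) = sin (real (Suc k) * \<theta> + \<theta>)"
    "sin (real k * \<theta>) = sin (real (Suc k) * \<theta> - \<theta>)"
    by (simp_all add: algebra_simps)
  then have "sin (real (Suc (Suc k)) * \<theta>) = 2 * cos \<theta> * sin (real (Suc k) * \<theta>) - sin (real k * \<theta>)"
    unfolding sin_add sin_diff by simp
  then show ?thesis
    using False by (simp add: cheb_U_def cos_m_def flip: \<theta>_def) (simp add: diff_divide_distrib)
qed

lemma cheb_U_norm:
  "(cheb_U s t (Suc k))\<^sup>2 + (cheb_U s t k)\<^sup>2 - 2 * cos_m s t * cheb_U s t k * cheb_U s t (Suc k) = 1"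
proof (induction k)
  case 0
  show ?case by (simp add: cheb_U_0 cheb_U_1)
next
  case (Suc k)
  show ?case unfolding cheb_U_rec Suc[symmetric] by (simp add: power2_eq_square algebra_simps)
qed

lemma cheb_U_m: "cheb_U s t (m s t) = 0"
  by (simp add: cheb_U_def)

lemma cheb_U_nonneg:
  assumes "m s t = 0 \<or> k \<le> m s t"
  shows "cheb_U s t k \<ge> 0"
proof (cases "m s t = 0")
  case True
  then show ?thesis by (simp add: cheb_U_def)
next
  case False
  have "k * (pi / m s t) \<le> pi" using assms False by (simp add: field_simps)
  then have "sin (k * (pi / m s t)) \<ge> 0" by (intro sin_ge_zero) auto
  then show ?thesis using sin_m_pos[OF st False] False by (simp add: cheb_U_def)
qed

text \<open>
  The plane spanned by \<open>\<alpha>\<^sub>s\<close> and \<open>\<alpha>\<^sub>t\<close> contains all displacements, and both displacement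
  coordinates carry the factor \<open>U\<close>, which vanishes at \<open>k = m\<close>. Hence the relator acts trivially,
  whatever the vector.
\<close>

lemma act_rotation_power:
  fixes v :: "'a \<Rightarrow> real" and k :: nat
  defines "x \<equiv> 2 * pair s v" and "y \<equiv> 2 * pair t v"
  defines "a \<equiv> cheb_U s t k" and "b \<equiv> cheb_U s t (Suc k)"
  shows "act_word (concat (replicate k [s, t])) v =
    (\<lambda>r. v r + (- (a * (a * x + b * y))) * simple_root s r
      + (- (a * (a * y + (2 * cos_m s t * a - b) * x))) * simple_root t r)"
  unfolding a_def b_def
proof (induction k)
  case 0
  show ?case by (simp add: cheb_U_0)
next
  case (Suc k)
  define c where "c = cos_m s t"
  define a b where "a = cheb_U s t k" and "b = cheb_U s t (Suc k)"
  define p q where "p = a * (a * x + b * y)" and "q = a * (a * y + (2 * c * a - b) * x)"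
  define v' where "v' = (\<lambda>r. v r + (- p) * simple_root s r + (- q) * simple_root t r)"
  have norm: "b * b = 1 - a * a + 2 * c * a * b"
    using cheb_U_norm[of k] by (simp add: a_def b_def c_def power2_eq_square)
  have rec: "cheb_U s t (Suc (Suc k)) = 2 * c * b - a"
    by (simp add: cheb_U_rec a_def b_def c_def)
  have cs: "cos_m t s = c" using st cos_m_sym c_def by metis
  have ps: "pair s v' = (x - 2 * p + 2 * c * q) / 2"
    and pt: "pair t v' = (y + 2 * c * p - 2 * q) / 2"
    unfolding v'_def pair_add pair_scale using st
    by (simp_all add: pair_root cs x_def y_def flip: c_def)
  have "act_word (concat (replicate (Suc k) [s, t])) v = reflect s (reflect t v')"
    using Suc by (simp add: v'_def p_def q_def a_def b_def c_def)
  also have "\<dots> = (\<lambda>r. v r + (- (x - p + 2 * c * (y + 2 * c * p - q))) * simple_root s r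
      + (- (y + 2 * c * p - q)) * simple_root t r)"
    unfolding reflect_def[of s "reflect t v'"] pair_reflect[OF st(2)]
    unfolding reflect_def ps pt c_def[symmetric]
    by (intro ext) (simp add: v'_def field_simps)
  also have "y + 2 * c * p - q = b * (b * y + a * x)"
  proof -
    have "b * (b * y + a * x) = (b * b) * y + a * b * x" by (simp add: algebra_simps)
    then show ?thesis unfolding norm by (simp add: p_def q_def algebra_simps)
  qed
  also have "x - p + 2 * c * (b * (b * y + a * x)) = b * (b * x + (2 * c * b - a) * y)"
  proof -
    have "x - p + 2 * c * (b * (b * y + a * x)) - b * (b * x + (2 * c * b - a) * y)
      = x * (1 - a * a + 2 * c * a * b - b * b)"
      by (simp add: p_def algebra_simps)
    then show ?thesis using norm by simp
  qed
  finally show ?case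
    by (simp add: rec flip: a_def b_def c_def)
qed

end

lemma act_relator:
  assumes "s \<in> S" "t \<in> S"
  shows "act_word (concat (replicate (m s t) [s, t])) v = v"
proof (cases "s = t")
  case True
  then show ?thesis using assms by (simp add: m_diag reflect_reflect)
next
  case False
  show ?thesis by (simp add: act_rotation_power[OF assms False] cheb_U_m[OF assms False])
qed

lemma act_word_equiv: "coxeter_equiv S m u u' \<Longrightarrow> act_word u v = act_word u' v"
  by (induction arbitrary: v rule: coxeter_equiv.induct) (auto simp: act_relator)

definition act :: "'a \<Rightarrow> ('a \<Rightarrow> real) \<Rightarrow> 'a \<Rightarrow> real" where
  "act w = act_word (SOME u. set u \<subseteq> S \<and> wp u = w)"

lemma act_wp [simp]:
  assumes "set u \<subseteq> S"
  shows "act (wp u) v = act_word u v"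
proof -
  let ?u = "SOME u'. set u' \<subseteq> S \<and> wp u' = wp u"
  have "set ?u \<subseteq> S \<and> wp ?u = wp u" by (rule someI[of _ u]) (use assms in auto)
  then have "coxeter_equiv S m ?u u" using pres[of ?u u] assms by (simp add: lists_eq_set)
  then show ?thesis unfolding act_def by (rule act_word_equiv)
qed

lemma act_one [simp]: "act \<one> v = v"
  using act_wp[of "[]"] by simp

lemma act_gen [simp]: "s \<in> S \<Longrightarrow> act s v = reflect s v"
  using act_wp[of "[s]"] by simp

lemma act_mult:
  assumes "x \<in> carrier W" "y \<in> carrier W"
  shows "act (x \<otimes> y) v = act x (act y v)"
proof -
  obtain u where u: "set u \<subseteq> S" "wp u = x" using ex_reduced_word assms by blast
  obtain u' where u': "set u' \<subseteq> S" "wp u' = y" using ex_reduced_word assms by blast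
  from u u' act_wp[of "u @ u'" v] show ?thesis by auto
qed

lemma act_lin:
  assumes "w \<in> carrier W"
  shows "act w (\<lambda>t. a * v t + b * u t) = (\<lambda>t. a * act w v t + b * act w u t)"
  unfolding act_def by (rule act_word_lin)

lemma act_root_expand:
  assumes "\<And>r. r \<notin> S \<Longrightarrow> v r = 0"
  shows "act w v = (\<lambda>t. \<Sum>s\<in>S. v s * act w (simple_root s) t)"
proof -
  have "v = (\<lambda>t. \<Sum>s\<in>S. v s * simple_root s t)"
    using finite_S assms
    by (auto simp: simple_root_def if_distrib[of "\<lambda>x. _ * x"] sum.delta' cong: if_cong)
  then have "act w v = act w (\<lambda>t. \<Sum>s\<in>S. v s * simple_root s t)" by simp
  then show ?thesis unfolding act_def using act_word_sum[OF finite_S] by simp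
qed

lemma act_supp:
  assumes "\<And>r. r \<notin> S \<Longrightarrow> v r = 0" "w \<in> carrier W" "r \<notin> S"
  shows "act w v r = 0"
proof -
  obtain u where u: "set u \<subseteq> S" "wp u = w" using ex_reduced_word assms by blast
  from u(1) have "act_word u v r = 0"
    using assms(1,3) by (induction u) (auto simp: reflect_def simple_root_def)
  then show ?thesis using u by auto
qed

lemma root_supp: "s \<in> S \<Longrightarrow> r \<notin> S \<Longrightarrow> simple_root s r = 0" by (auto simp: simple_root_def)

section \<open>Positivity of roots\<close>

fun alt_word :: "'a \<Rightarrow> 'a \<Rightarrow> nat \<Rightarrow> 'a list" where
  "alt_word s t 0 = []"
| "alt_word s t (Suc k) = (if even k then t else s) # alt_word s t k"

lemma length_alt [simp]: "length (alt_word s t k) = k" by (induction k) auto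

lemma set_alt: "s \<in> S \<Longrightarrow> t \<in> S \<Longrightarrow> set (alt_word s t k) \<subseteq> S" by (induction k) auto

lemma alt_snoc: "alt_word s t (Suc k) = alt_word t s k @ [t]" by (induction k) auto

lemma alt_double: "alt_word s t (2 * k) = concat (replicate k [s, t])" by (induction k) auto

lemma alt_split: "\<exists>u. alt_word s t (j + k) = u @ alt_word s t k \<and> length u = j \<and> set u \<subseteq> {s, t}"
proof (induction j)
  case (Suc j)
  then obtain u where "alt_word s t (j + k) = u @ alt_word s t k" "length u = j" "set u \<subseteq> {s, t}" by auto
  then show ?case by (intro exI[of _ "(if even (j + k) then t else s) # u"]) auto
qed auto

text \<open>
  An alternating word of length \<open>m + 1\<close> is the inverse of the alternating word of length \<open>m - 1\<close>
  that completes it to a relator, so a word ending in it is not reduced.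
\<close>

lemma len_alt_mult:
  assumes "s \<in> S" "t \<in> S" "m s t \<noteq> 0" "m s t \<le> k"
  shows "len (wp (alt_word s t k) \<otimes> s) < k"
proof -
  let ?m = "m s t"
  have 0: "alt_word t s (Suc k) = alt_word s t k @ [s]" by (rule alt_snoc)
  have st: "set (alt_word s' t' j) \<subseteq> S" if "s' \<in> {s,t}" "t' \<in> {s,t}" for s' t' j
    using set_alt[of s' t'] assms that by auto
  obtain u where u: "alt_word t s ((?m - 1) + Suc ?m) = u @ alt_word t s (Suc ?m)" "length u = ?m - 1" "set u \<subseteq> {t, s}"
    using alt_split by metis
  have "(?m - 1) + Suc ?m = 2 * ?m" using assms by auto
  then have "alt_word t s (2 * ?m) = u @ alt_word t s (Suc ?m)" using u(1) by (rule subst)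
  then have "wp (u @ alt_word t s (Suc ?m)) = wp (concat (replicate (m t s) [t, s]))"
    unfolding alt_double using m_sym[OF assms(1,2)] by (intro arg_cong[of _ _ wp]) simp
  then have "wp (u @ alt_word t s (Suc ?m)) = \<one>"
    using wp_relator[OF assms(2,1)] by (rule HOL.trans)
  moreover have uS: "set u \<subseteq> S" using u assms by auto
  ultimately have "wp u \<otimes> wp (alt_word t s (Suc ?m)) = \<one>" using st by (simp del: alt_word.simps)
  then have "inv (wp (alt_word t s (Suc ?m))) = wp u"
    by (rule inv_equality) (use st[of t s] uS in \<open>auto simp del: alt_word.simps\<close>)
  then have 1: "len (wp (alt_word t s (Suc ?m))) \<le> ?m - 1"
    using len_inv[of "wp (alt_word t s (Suc ?m))"] len_wp_le[OF uS] u(2) st[of t s "Suc ?m"]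
    by (simp del: alt_word.simps len_inv)
  obtain u' where u': "alt_word t s ((k - ?m) + Suc ?m) = u' @ alt_word t s (Suc ?m)" "length u' = k - ?m" "set u' \<subseteq> {t, s}"
    using alt_split by metis
  have "(k - ?m) + Suc ?m = Suc k" using assms by auto
  moreover have u'S: "set u' \<subseteq> S" using u' assms by auto
  ultimately have "alt_word s t k @ [s] = u' @ alt_word t s (Suc ?m)"
    using u'(1) 0 by (simp only:)
  then have "wp (alt_word s t k @ [s]) = wp (u' @ alt_word t s (Suc ?m))" by (rule arg_cong)
  then have "wp (alt_word s t k) \<otimes> s = wp u' \<otimes> wp (alt_word t s (Suc ?m))"
    using st[of s t k] st[of t s "Suc ?m"] u'S assms(1) by (simp del: alt_word.simps)
  moreover have "len (wp u' \<otimes> wp (alt_word t s (Suc ?m))) \<le> len (wp u') + len (wp (alt_word t s (Suc ?m)))"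
    by (rule len_mult_le) (use u'S st[of t s "Suc ?m"] in \<open>auto simp del: alt_word.simps\<close>)
  ultimately have "len (wp (alt_word s t k) \<otimes> s) \<le> (k - ?m) + (?m - 1)"
    using len_wp_le[OF u'S] u'(2) 1 by (simp del: alt_word.simps)
  also have "\<dots> < k" using assms by auto
  finally show ?thesis .
qed

lemma act_alt:
  assumes "s \<in> S" "t \<in> S" "s \<noteq> t"
  shows "act_word (alt_word s t k) (simple_root s) =
    (\<lambda>r. cheb_U s t (Suc k) * simple_root (if even k then s else t) r + cheb_U s t k * simple_root (if even k then t else s) r)"
proof (induction k)
  case 0
  then show ?case using assms by (simp add: cheb_U_0 cheb_U_1)
next
  case (Suc k)
  have "cos_m t s = cos_m s t" using assms cos_m_sym by metis
  then show ?case unfolding alt_word.simps act_word_simps Suc reflect_lin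
    using assms by (auto simp: reflect_root cheb_U_rec algebra_simps)
qed

text \<open>
  Choose a right descent \<open>t\<close> of \<open>w\<close> and write \<open>w = v d\<close> with \<open>d\<close> an alternating word in \<open>s\<close> and
  \<open>t\<close> that ends in \<open>t\<close>, with lengths adding up and \<open>d\<close> as long as possible. Then \<open>v\<close> is shorter
  than \<open>w\<close> and has neither \<open>s\<close> nor \<open>t\<close> as a right descent, so by induction \<open>v\<close> maps \<open>\<alpha>\<^sub>s\<close> and
  \<open>\<alpha>\<^sub>t\<close> to nonnegative vectors. The length of \<open>d\<close> is below \<open>m(s,t)\<close> because \<open>s\<close> is no descent of
  \<open>w\<close>, so that \<open>d \<alpha>\<^sub>s\<close> is a nonnegative combination of \<open>\<alpha>\<^sub>s\<close> and \<open>\<alpha>\<^sub>t\<close>.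
\<close>

theorem root_nonneg:
  assumes "w \<in> carrier W" "s \<in> S" "len w < len (w \<otimes> s)"
  shows "act w (simple_root s) r \<ge> 0"
  using assms
proof (induction "len w" arbitrary: w s r rule: less_induct)
  case less
  show ?case
  proof (cases "w = \<one>")
    case True
    then show ?thesis by (simp add: simple_root_def)
  next
    case False
    then obtain t where t: "t \<in> S" "len (w \<otimes> t) < len w" using ex_descent less.prems(1) by blast
    then have st: "s \<noteq> t" using less.prems by auto
    define P where "P k v \<longleftrightarrow> v \<in> carrier W \<and> w = v \<otimes> wp (alt_word s t k) \<and> len w = len v + k" for k v
    have S': "set (alt_word s t k) \<subseteq> S" for k using set_alt less.prems t by simp
    have "P 1 (w \<otimes> t)"
      using less.prems t len_mult_gen_cases[of w t] by (auto simp: P_def)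
    moreover have "\<forall>k. (\<exists>v. P k v) \<longrightarrow> k \<le> len w" by (auto simp: P_def)
    ultimately obtain k where k: "\<exists>v. P k v" "\<And>j. (\<exists>v. P j v) \<Longrightarrow> j \<le> k"
      using Nat.ex_has_greatest_nat[of "\<lambda>k. \<exists>v. P k v" 1 "len w"] by blast
    then have "k \<ge> 1" using \<open>P 1 (w \<otimes> t)\<close> by blast
    from k(1) obtain v where v: "v \<in> carrier W" "w = v \<otimes> wp (alt_word s t k)" "len w = len v + k"
      by (auto simp: P_def)
    \<comment> \<open>\<open>y\<close> is the first letter of the alternating word, and \<open>x\<close> the letter that would extend it to the left.\<close>
    define x where "x = (if even k then t else s)"
    define y where "y = (if even k then s else t)"
    have xy: "x \<in> S" "y \<in> S" using less.prems t by (auto simp: x_def y_def)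
    have "len v < len (v \<otimes> x)"
    proof (rule ccontr)
      assume "\<not> ?thesis"
      then have "Suc (len (v \<otimes> x)) = len v" using len_mult_gen_cases v xy by fastforce
      moreover have "w = v \<otimes> x \<otimes> wp (alt_word s t (Suc k))"
        using v(1,2) xy S'[of k] by (simp add: m_assoc flip: x_def)
      ultimately have "P (Suc k) (v \<otimes> x)" using v xy by (auto simp: P_def)
      then show False using k(2)[of "Suc k"] by auto
    qed
    moreover have "len v < len (v \<otimes> y)"
    proof (rule ccontr)
      assume "\<not> ?thesis"
      then have vy: "Suc (len (v \<otimes> y)) = len v" using len_mult_gen_cases v xy by fastforce
      obtain j where j: "k = Suc j" using \<open>k \<ge> 1\<close> by (cases k) auto
      have "w = v \<otimes> y \<otimes> wp (alt_word s t j)"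
        using v(1,2) xy S'[of j] by (auto simp: m_assoc j y_def)
      then have "len w \<le> len (v \<otimes> y) + j"
        using len_mult_le[of "v \<otimes> y" "wp (alt_word s t j)"] len_wp_le[OF S'[of j]] v xy S'[of j] by simp
      then show False using vy v(3) j by simp
    qed
    moreover have "len v < len w" using v \<open>k \<ge> 1\<close> by simp
    ultimately have pos: "act v (simple_root x) r \<ge> 0" "act v (simple_root y) r \<ge> 0"
      using less.hyps v(1) xy by blast+
    have km: "m s t = 0 \<or> Suc k \<le> m s t"
    proof (rule ccontr)
      assume "\<not> ?thesis"
      then have "m s t \<noteq> 0" "m s t \<le> k" by auto
      then have "len (wp (alt_word s t k) \<otimes> s) < k" using len_alt_mult less.prems t by blast
      moreover have "w \<otimes> s = v \<otimes> (wp (alt_word s t k) \<otimes> s)"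
        using v(1,2) S' less.prems(2) by (simp add: m_assoc)
      then have "len (w \<otimes> s) \<le> len v + len (wp (alt_word s t k) \<otimes> s)"
        using len_mult_le[of v "wp (alt_word s t k) \<otimes> s"] v(1) S' less.prems(2) by simp
      ultimately show False using v(3) less.prems(3) by linarith
    qed
    have "act w (simple_root s) = act v (act_word (alt_word s t k) (simple_root s))"
      using v S' by (simp add: act_mult)
    also have "\<dots> = (\<lambda>r. cheb_U s t (Suc k) * act v (simple_root y) r + cheb_U s t k * act v (simple_root x) r)"
      unfolding act_alt[OF less.prems(2) t(1) st] act_lin[OF v(1)] by (simp add: x_def y_def)
    finally have "act w (simple_root s) r =
      cheb_U s t (Suc k) * act v (simple_root y) r + cheb_U s t k * act v (simple_root x) r" by simp
    moreover have "cheb_U s t (Suc k) \<ge> 0" "cheb_U s t k \<ge> 0"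
      using km by (auto intro: cheb_U_nonneg[OF less.prems(2) t(1) st])
    ultimately show ?thesis using pos by simp
  qed
qed

definition roots :: "('a \<Rightarrow> real) set" where
  "roots = {act w (simple_root s) | w s. w \<in> carrier W \<and> s \<in> S}"

definition pos_roots :: "('a \<Rightarrow> real) set" where
  "pos_roots = {\<beta> \<in> roots. \<forall>r. \<beta> r \<ge> 0}"

definition height :: "('a \<Rightarrow> real) \<Rightarrow> real" where
  "height v = (\<Sum>r\<in>S. v r)"

lemma rootsE:
  assumes "\<beta> \<in> roots"
  obtains w s where "w \<in> carrier W" "s \<in> S" "\<beta> = act w (simple_root s)"
  using assms unfolding roots_def by blast

lemma act_uminus: "act w (\<lambda>r. - v r) = (\<lambda>r. - act w v r)"
  using act_word_lin[of _ "-1" v 0 v] by (simp add: act_def)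

lemma act_reflect: "\<lbrakk>s \<in> S; w \<in> carrier W\<rbrakk> \<Longrightarrow> act w (reflect s v) = act (w \<otimes> s) v"
  by (simp add: act_mult)

lemma act_act_inv: "w \<in> carrier W \<Longrightarrow> act w (act (inv w) v) = v"
  by (simp flip: act_mult)

lemma reflect_self: "s \<in> S \<Longrightarrow> reflect s (simple_root s) = (\<lambda>r. - simple_root s r)"
  by (simp add: reflect_root)

lemma act_gen_root: "\<lbrakk>w \<in> carrier W; s \<in> S\<rbrakk> \<Longrightarrow> act (w \<otimes> s) (simple_root s) = (\<lambda>r. - act w (simple_root s) r)"
  by (simp add: act_mult reflect_self act_uminus)

lemma root_in_roots: "s \<in> S \<Longrightarrow> simple_root s \<in> roots"
  unfolding roots_def using act_one by (force intro: exI[of _ \<one>])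

lemma act_roots: "\<lbrakk>w \<in> carrier W; \<beta> \<in> roots\<rbrakk> \<Longrightarrow> act w \<beta> \<in> roots"
  unfolding roots_def by (force simp flip: act_mult)

lemma finite_roots: "finite roots"
  unfolding roots_def by (rule finite_image_set2) (simp_all add: fin finite_S)

lemma finite_pos_roots: "finite pos_roots"
  unfolding pos_roots_def using finite_roots by simp

lemma roots_supp: "\<beta> \<in> roots \<Longrightarrow> r \<notin> S \<Longrightarrow> \<beta> r = 0"
  by (elim rootsE) (simp add: act_supp root_supp)

lemma act_root_in_roots: "\<lbrakk>w \<in> carrier W; s \<in> S\<rbrakk> \<Longrightarrow> act w (simple_root s) \<in> roots"
  by (intro act_roots root_in_roots)

lemma roots_uminus:
  assumes "\<beta> \<in> roots"
  shows "(\<lambda>r. - \<beta> r) \<in> roots"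
proof -
  obtain w s where ws: "w \<in> carrier W" "s \<in> S" "\<beta> = act w (simple_root s)"
    using rootsE assms by blast
  show ?thesis
    using act_root_in_roots[of "w \<otimes> s" s] ws by (simp add: act_gen_root)
qed

lemma act_root_pos:
  assumes "w \<in> carrier W" "s \<in> S" "len w < len (w \<otimes> s)"
  shows "act w (simple_root s) \<in> pos_roots"
  unfolding pos_roots_def
  using root_nonneg[OF assms] act_roots[OF assms(1) root_in_roots[OF assms(2)]] by simp

lemma act_root_neg:
  assumes "w \<in> carrier W" "s \<in> S" "len (w \<otimes> s) < len w"
  shows "(\<lambda>r. - act w (simple_root s) r) \<in> pos_roots"
  using act_root_pos[of "w \<otimes> s" s] assms by (simp add: act_gen_root)

lemma root_pos: "s \<in> S \<Longrightarrow> simple_root s \<in> pos_roots"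
  by (simp add: pos_roots_def root_in_roots) (simp add: simple_root_def)

lemma roots_cases: "\<beta> \<in> roots \<Longrightarrow> \<beta> \<in> pos_roots \<or> (\<lambda>r. - \<beta> r) \<in> pos_roots"
proof (elim rootsE)
  fix w s assume ws: "w \<in> carrier W" "s \<in> S" "\<beta> = act w (simple_root s)"
  from len_mult_gen_cases[OF ws(1,2)] show ?thesis
  proof
    assume "len (w \<otimes> s) = Suc (len w)"
    then show ?thesis using act_root_pos[OF ws(1,2)] ws(3) by simp
  next
    assume "Suc (len (w \<otimes> s)) = len w"
    then show ?thesis using act_root_neg[OF ws(1,2)] ws(3) by simp
  qed
qed

lemma form_root: "s \<in> S \<Longrightarrow> form (simple_root s) v = pair s v"
  using finite_S by (simp add: form_def simple_root_def if_distrib[of "\<lambda>x. x * _"] cong: if_cong)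

lemma form_root_right: "s \<in> S \<Longrightarrow> form v (simple_root s) = pair s v"
  unfolding form_def pair_def[of s v] by (intro sum.cong) (auto simp: pair_root cos_m_sym)

lemma form_reflect:
  assumes "s \<in> S"
  shows "form (reflect s u) (reflect s v) = form u v"
proof -
  have left: "form (reflect s u) z = form u z - 2 * pair s u * form (simple_root s) z" for u z
    by (simp add: form_def reflect_def algebra_simps sum_subtractf sum_distrib_left)
  have right: "form u (reflect s v) = form u v - 2 * pair s v * form u (simple_root s)" for u v
  proof -
    have "form u (reflect s v) = (\<Sum>r\<in>S. u r * (pair r v - 2 * pair s v * pair r (simple_root s)))"
      by (simp only: form_def reflect_def pair_diff pair_scale)
    then show ?thesis
      by (simp add: form_def right_diff_distrib sum_subtractf sum_distrib_left mult.left_commute)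
  qed
  show ?thesis unfolding left right using assms
    by (simp add: form_root form_root_right pair_root algebra_simps)
qed

lemma form_act:
  assumes "w \<in> carrier W"
  shows "form (act w u) (act w v) = form u v"
proof -
  obtain x where x: "set x \<subseteq> S" "wp x = w" using ex_reduced_word assms by blast
  have "form (act_word x u) (act_word x v) = form u v"
    using x(1) by (induction x) (auto simp: form_reflect)
  then show ?thesis using x act_wp by metis
qed

lemma roots_norm: "\<beta> \<in> roots \<Longrightarrow> form \<beta> \<beta> = 1"
  by (elim rootsE) (simp add: form_act form_root pair_root)

text \<open>
  A root has norm \<open>1\<close> by invariance of the form, so its coordinates are not all zero.
\<close>

lemma height_pos:
  assumes "\<beta> \<in> pos_roots"
  shows "height \<beta> > 0"
proof (rule ccontr)
  have nn: "\<beta> r \<ge> 0" for r using assms by (auto simp: pos_roots_def)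
  assume "\<not> ?thesis"
  then have "(\<Sum>r\<in>S. \<beta> r) = 0" using sum_nonneg[of S \<beta>] nn by (auto simp: height_def not_less)
  then have "\<forall>r\<in>S. \<beta> r = 0" using sum_nonneg_eq_0_iff[OF finite_S] nn by auto
  then have "form \<beta> \<beta> = 0" by (simp add: form_def)
  then show False using roots_norm assms by (auto simp: pos_roots_def)
qed

lemma height_uminus: "height (\<lambda>r. - v r) = - height v"
  by (simp add: height_def sum_negf)

lemma uminus_pos_roots: "\<beta> \<in> pos_roots \<Longrightarrow> (\<lambda>r. - \<beta> r) \<notin> pos_roots"
  using height_pos[of \<beta>] height_pos[of "\<lambda>r. - \<beta> r"] height_uminus[of \<beta>] by auto

lemma not_pos_roots: "\<beta> \<in> roots \<Longrightarrow> \<beta> \<notin> pos_roots \<longleftrightarrow> (\<lambda>r. - \<beta> r) \<in> pos_roots"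
  using roots_cases uminus_pos_roots by blast

lemma pos_roots_sub: "\<beta> \<in> pos_roots \<Longrightarrow> \<beta> \<in> roots" by (simp add: pos_roots_def)

text \<open>
  The reflection changes only the coordinate at \<open>s\<close>, so a positive root made negative by it is a
  multiple of \<open>\<alpha>\<^sub>s\<close>; by the norm the factor is \<open>1\<close>.
\<close>

lemma reflect_pos_roots:
  assumes s: "s \<in> S" and \<beta>: "\<beta> \<in> pos_roots" and ne: "\<beta> \<noteq> simple_root s"
  shows "reflect s \<beta> \<in> pos_roots"
proof (rule ccontr)
  assume "\<not> ?thesis"
  moreover have "reflect s \<beta> \<in> roots" using act_roots[of s \<beta>] s \<beta> by (simp add: pos_roots_sub)
  ultimately have neg: "(\<lambda>r. - reflect s \<beta> r) \<in> pos_roots" by (simp add: not_pos_roots)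
  have "\<beta> r = 0" if "r \<noteq> s" for r
  proof -
    have "reflect s \<beta> r = \<beta> r" using that by (simp add: reflect_def simple_root_def)
    moreover have "- reflect s \<beta> r \<ge> 0" using neg by (auto simp: pos_roots_def)
    moreover have "\<beta> r \<ge> 0" using \<beta> by (auto simp: pos_roots_def)
    ultimately show ?thesis by linarith
  qed
  then have eq: "\<beta> = (\<lambda>r. \<beta> s * simple_root s r)" by (auto simp: simple_root_def)
  have "1 = form \<beta> \<beta>" using roots_norm \<beta> by (simp add: pos_roots_sub)
  also have "\<dots> = form (\<lambda>r. \<beta> s * simple_root s r) (\<lambda>r. \<beta> s * simple_root s r)" using eq by simp
  also have "\<dots> = \<beta> s * (\<beta> s * form (simple_root s) (simple_root s))"
    by (simp add: form_def pair_scale sum_distrib_left mult_ac)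
  also have "\<dots> = (\<beta> s)\<^sup>2" using s by (simp add: form_root pair_root power2_eq_square)
  finally have "\<beta> s = 1" using \<beta> by (auto simp: pos_roots_def power2_eq_1_iff dest: spec[of _ s])
  then show False using eq ne by simp
qed

section \<open>Length and inversions\<close>

definition inversions :: "'a \<Rightarrow> ('a \<Rightarrow> real) set" where
  "inversions w = {\<beta> \<in> pos_roots. act w \<beta> \<notin> pos_roots}"

lemma inversions_mult_gen:
  assumes w: "w \<in> carrier W" and s: "s \<in> S" and l: "len w < len (w \<otimes> s)"
  shows "inversions (w \<otimes> s) = insert (simple_root s) (reflect s ` inversions w)"
proof (intro equalityI subsetI)
  fix \<beta> assume \<beta>: "\<beta> \<in> inversions (w \<otimes> s)"
  show "\<beta> \<in> insert (simple_root s) (reflect s ` inversions w)"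
  proof (cases "\<beta> = simple_root s")
    case False
    then have "reflect s \<beta> \<in> pos_roots" using reflect_pos_roots s \<beta> by (auto simp: inversions_def)
    then have "reflect s \<beta> \<in> inversions w" using \<beta> w s by (auto simp: inversions_def act_reflect)
    then have "reflect s (reflect s \<beta>) \<in> reflect s ` inversions w" by (rule imageI)
    then show ?thesis by (simp add: reflect_reflect[OF s])
  qed simp
next
  fix \<beta> assume "\<beta> \<in> insert (simple_root s) (reflect s ` inversions w)"
  then consider "\<beta> = simple_root s" | \<gamma> where "\<gamma> \<in> inversions w" "\<beta> = reflect s \<gamma>" by blast
  then show "\<beta> \<in> inversions (w \<otimes> s)"
  proof cases
    case 1
    then show ?thesis using act_root_pos[OF assms] s w uminus_pos_roots root_pos
      by (simp add: inversions_def act_gen_root)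
  next
    case 2
    then have "\<gamma> \<noteq> simple_root s" using act_root_pos[OF assms] by (auto simp: inversions_def)
    then show ?thesis using 2 s w reflect_pos_roots
      by (auto simp: inversions_def act_mult reflect_reflect)
  qed
qed

lemma finite_inversions: "finite (inversions w)"
  using finite_pos_roots by (simp add: inversions_def)

lemma card_inversions:
  assumes "w \<in> carrier W"
  shows "card (inversions w) = len w"
  using assms
proof (induction "len w" arbitrary: w)
  case 0
  then show ?case by (simp add: len_0_iff inversions_def)
next
  case (Suc n)
  then have "w \<noteq> \<one>" by auto
  then obtain s where s: "s \<in> S" "len (w \<otimes> s) < len w" using ex_descent Suc.prems by blast
  define v where "v = w \<otimes> s"
  have v: "v \<in> carrier W" "w = v \<otimes> s" "len v < len (v \<otimes> s)" "len w = Suc (len v)"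
    using s Suc.prems len_mult_gen_cases[of w s] by (auto simp: v_def)
  have "inj_on (reflect s) (inversions v)" using reflect_reflect[OF s(1)] by (intro inj_on_inverseI[of _ "reflect s"]) simp
  moreover have "simple_root s \<notin> reflect s ` inversions v"
  proof
    assume "simple_root s \<in> reflect s ` inversions v"
    then obtain \<beta> where \<beta>: "\<beta> \<in> pos_roots" "simple_root s = reflect s \<beta>" by (auto simp: inversions_def)
    have "\<beta> = reflect s (reflect s \<beta>)" by (simp only: reflect_reflect[OF s(1)])
    also have "\<dots> = reflect s (simple_root s)" by (simp only: \<beta>(2))
    also have "\<dots> = (\<lambda>r. - simple_root s r)" by (rule reflect_self[OF s(1)])
    finally have "\<beta> = (\<lambda>r. - simple_root s r)" .
    then show False using \<beta>(1) uminus_pos_roots[OF root_pos[OF s(1)]] by simp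
  qed
  ultimately have "card (inversions w) = Suc (card (inversions v))"
    unfolding v(2) inversions_mult_gen[OF v(1) s(1) v(3)]
    using finite_inversions by (simp add: card_image)
  then show ?case using Suc v by simp
qed

lemma eq_one_if_no_inversions:
  assumes "w \<in> carrier W" "\<And>\<beta>. \<beta> \<in> pos_roots \<Longrightarrow> act w \<beta> \<in> pos_roots"
  shows "w = \<one>"
proof -
  have "inversions w = {}" using assms by (auto simp: inversions_def)
  then show ?thesis using card_inversions[OF assms(1)] len_0_iff assms(1) by simp
qed

section \<open>The longest element\<close>

lemma maximal_inverts_all:
  assumes w: "w \<in> carrier W" and max: "\<forall>v\<in>carrier W. len v \<le> len w" and \<beta>: "\<beta> \<in> pos_roots"
  shows "(\<lambda>r. - act w \<beta> r) \<in> pos_roots"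
proof -
  have "act w (simple_root s) r \<le> 0" if s: "s \<in> S" for s r
  proof -
    have "len (w \<otimes> s) < len w" using max[rule_format, of "w \<otimes> s"] len_mult_gen_cases[OF w s] w s by auto
    from act_root_neg[OF w s this] have "- act w (simple_root s) r \<ge> 0" by (auto simp: pos_roots_def)
    then show ?thesis by simp
  qed
  moreover have "act w \<beta> = (\<lambda>r. \<Sum>s\<in>S. \<beta> s * act w (simple_root s) r)"
    by (rule act_root_expand) (use \<beta> roots_supp pos_roots_sub in blast)
  moreover have "\<beta> s \<ge> 0" for s using \<beta> by (auto simp: pos_roots_def)
  ultimately have "act w \<beta> r \<le> 0" for r by (simp add: sum_nonpos mult_nonneg_nonpos)
  then show ?thesis using act_roots[OF w, of \<beta>] \<beta> roots_uminus by (auto simp: pos_roots_def)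
qed

text \<open>
  Two elements that send all positive roots to negative ones differ by an element that preserves
  positivity; such an element has no inversions, hence length \<open>0\<close>.
\<close>

lemma maximal_unique:
  assumes w: "w \<in> carrier W" "\<forall>v\<in>carrier W. len v \<le> len w"
    and w': "w' \<in> carrier W" "\<forall>v\<in>carrier W. len v \<le> len w'"
  shows "w = w'"
proof -
  have "inv w \<otimes> w' = \<one>"
  proof (rule eq_one_if_no_inversions)
    fix \<beta> assume \<beta>: "\<beta> \<in> pos_roots"
    define \<gamma> where "\<gamma> = (\<lambda>r. - act w' \<beta> r)"
    have \<gamma>: "\<gamma> \<in> pos_roots" using maximal_inverts_all[OF w' \<beta>] by (simp add: \<gamma>_def)
    have "act (inv w) \<gamma> \<notin> pos_roots"
    proof
      assume "act (inv w) \<gamma> \<in> pos_roots"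
      from maximal_inverts_all[OF w this] show False
        using w \<gamma> uminus_pos_roots by (simp add: act_act_inv)
    qed
    moreover have "act (inv w) \<gamma> \<in> roots" using act_roots \<gamma> w by (simp add: pos_roots_sub)
    ultimately have "(\<lambda>r. - act (inv w) \<gamma> r) \<in> pos_roots" by (simp add: not_pos_roots)
    then show "act (inv w \<otimes> w') \<beta> \<in> pos_roots"
      using w w' by (simp add: \<gamma>_def act_uminus act_mult)
  qed (use w w' in auto)
  then have "w \<otimes> (inv w \<otimes> w') = w" using w by simp
  then show ?thesis using w w' by (simp flip: m_assoc)
qed

definition w0 where "w0 = longest_element W S"

lemma w0_props: "w0 \<in> carrier W \<and> (\<forall>v\<in>carrier W. len v \<le> len w0)"
  unfolding w0_def longest_element_def
proof (rule theI')
  have "Max (len ` carrier W) \<in> len ` carrier W"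
    using fin one_closed by (intro Max_in) auto
  then obtain w where "w \<in> carrier W" "len w = Max (len ` carrier W)" by auto
  then have "\<exists>w\<in>carrier W. \<forall>v\<in>carrier W. len v \<le> len w"
    using fin by (intro bexI[of _ w]) auto
  then show "\<exists>!w. w \<in> carrier W \<and> (\<forall>v\<in>carrier W. len v \<le> len w)"
    using maximal_unique by blast
qed

lemma w0_closed [simp]: "w0 \<in> carrier W" using w0_props by blast

lemma len_le_w0: "w \<in> carrier W \<Longrightarrow> len w \<le> len w0" using w0_props by blast

lemma w0_square [simp]: "w0 \<otimes> w0 = \<one>"
proof -
  have "inv w0 = w0" by (rule maximal_unique) (auto intro: len_le_w0)
  then show ?thesis by (metis r_inv w0_closed)
qed

lemma w0_w0_mult [simp]: "w \<in> carrier W \<Longrightarrow> w0 \<otimes> (w0 \<otimes> w) = w"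
  by (simp flip: m_assoc)

lemma w0_neg: "\<beta> \<in> pos_roots \<Longrightarrow> (\<lambda>r. - act w0 \<beta> r) \<in> pos_roots"
  using maximal_inverts_all w0_props by blast

lemma w0_roots:
  assumes "\<beta> \<in> roots"
  shows "act w0 \<beta> \<in> pos_roots \<longleftrightarrow> \<beta> \<notin> pos_roots"
proof
  assume "act w0 \<beta> \<in> pos_roots"
  then show "\<beta> \<notin> pos_roots" using w0_neg uminus_pos_roots by blast
next
  assume "\<beta> \<notin> pos_roots"
  then have "(\<lambda>r. - \<beta> r) \<in> pos_roots" using assms not_pos_roots by blast
  from w0_neg[OF this] show "act w0 \<beta> \<in> pos_roots" by (simp add: act_uminus)
qed

lemma len_w0: "len w0 = card pos_roots"
proof -
  have "inversions w0 = pos_roots" using w0_roots pos_roots_sub by (auto simp: inversions_def)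
  then show ?thesis using card_inversions[of w0] by simp
qed

lemma len_w0_mult:
  assumes "w \<in> carrier W"
  shows "len (w0 \<otimes> w) = len w0 - len w"
proof -
  have "inversions (w0 \<otimes> w) = pos_roots - inversions w"
    using assms w0_roots act_roots[OF assms] pos_roots_sub by (auto simp: inversions_def act_mult)
  moreover have "inversions w \<subseteq> pos_roots" by (auto simp: inversions_def)
  ultimately have "card (inversions (w0 \<otimes> w)) = card pos_roots - card (inversions w)"
    using finite_inversions by (simp add: card_Diff_subset)
  then show ?thesis using assms card_inversions len_w0 by simp
qed

text \<open>
  Antisymmetrizing the height makes \<open>\<phi>\<close> odd under \<open>w0\<close>; it stays positive on positive roots
  because \<open>w0\<close> makes all of them negative.
\<close>

definition \<phi> :: "('a \<Rightarrow> real) \<Rightarrow> real" where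
  "\<phi> v = height v - height (act w0 v)"

lemma phi_lin: "\<phi> (\<lambda>r. a * v r + b * u r) = a * \<phi> v + b * \<phi> u"
  by (simp add: \<phi>_def act_lin height_def sum.distrib sum_distrib_left algebra_simps)

lemma phi_uminus: "\<phi> (\<lambda>r. - v r) = - \<phi> v"
  by (simp add: \<phi>_def act_uminus height_uminus)

lemma phi_w0: "\<phi> (act w0 v) = - \<phi> v"
  by (simp add: \<phi>_def flip: act_mult)

lemma phi_pos: "\<beta> \<in> pos_roots \<Longrightarrow> \<phi> \<beta> > 0"
  using height_pos[of \<beta>] height_pos[OF w0_neg, of \<beta>] by (simp add: \<phi>_def height_uminus)

lemma phi_neg: "(\<lambda>r. - \<beta> r) \<in> pos_roots \<Longrightarrow> \<phi> \<beta> < 0"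
  using phi_pos[of "\<lambda>r. - \<beta> r"] by (simp add: phi_uminus)

lemma phi_roots: "\<beta> \<in> roots \<Longrightarrow> \<phi> \<beta> \<noteq> 0"
  using roots_cases phi_pos phi_neg by fastforce

section \<open>Divided differences and the degree filtration\<close>

definition root_val :: "'a \<Rightarrow> 'a \<Rightarrow> real" where
  "root_val s x = \<phi> (act x (simple_root s))"

definition divdiff :: "'a \<Rightarrow> ('a \<Rightarrow> real) \<Rightarrow> 'a \<Rightarrow> real" where
  "divdiff s f = (\<lambda>x. (f x - f (x \<otimes> s)) / root_val s x)"

definition divdiffs :: "'a list \<Rightarrow> ('a \<Rightarrow> real) \<Rightarrow> 'a \<Rightarrow> real" where
  "divdiffs u = foldr divdiff u"

text \<open>
  A polynomial of degree less than \<open>k\<close> is killed by every product of \<open>k\<close> divided differences.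
  This property is taken as the definition of the degree, so that no polynomials have to be
  chosen.
\<close>

definition deg_less :: "nat \<Rightarrow> ('a \<Rightarrow> real) \<Rightarrow> bool" where
  "deg_less k f \<longleftrightarrow>
    (\<forall>u x. set u \<subseteq> S \<longrightarrow> length u = k \<longrightarrow> x \<in> carrier W \<longrightarrow> divdiffs u f x = 0)"

lemma root_val_nonzero: "\<lbrakk>s \<in> S; x \<in> carrier W\<rbrakk> \<Longrightarrow> root_val s x \<noteq> 0"
  unfolding root_val_def by (intro phi_roots act_root_in_roots)

lemma root_val_mult_gen: "\<lbrakk>s \<in> S; x \<in> carrier W\<rbrakk> \<Longrightarrow> root_val s (x \<otimes> s) = - root_val s x"
  by (simp add: root_val_def act_gen_root phi_uminus)

lemma root_val_w0: "\<lbrakk>s \<in> S; x \<in> carrier W\<rbrakk> \<Longrightarrow> root_val s (w0 \<otimes> x) = - root_val s x"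
  by (simp add: root_val_def act_mult phi_w0)

lemma divdiffs_simps [simp]:
  "divdiffs [] f = f" "divdiffs (s # u) f = divdiff s (divdiffs u f)" "divdiffs (u @ v) f = divdiffs u (divdiffs v f)"
  by (simp_all add: divdiffs_def)

lemma divdiffs_cong:
  assumes "set u \<subseteq> S" "x \<in> carrier W" "\<And>x. x \<in> carrier W \<Longrightarrow> f x = g x"
  shows "divdiffs u f x = divdiffs u g x"
  using assms(1,2)
proof (induction u arbitrary: x)
  case (Cons s u)
  then show ?case by (simp add: divdiff_def)
qed (simp add: assms(3))

lemma divdiff_lin: "divdiff s (\<lambda>x. a * f x + b * g x) = (\<lambda>x. a * divdiff s f x + b * divdiff s g x)"
  by (rule ext) (simp add: divdiff_def add_divide_distrib[symmetric] right_diff_distrib algebra_simps)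

lemma divdiffs_lin: "divdiffs u (\<lambda>x. a * f x + b * g x) = (\<lambda>x. a * divdiffs u f x + b * divdiffs u g x)"
  by (induction u) (simp_all add: divdiff_lin)

lemma divdiffs_zero: "divdiffs u (\<lambda>x. 0) = (\<lambda>x. 0)"
  using divdiffs_lin[of u 0 "\<lambda>x. 0" 0 "\<lambda>x. 0"] by simp

lemma divdiffs_sum:
  assumes "finite I"
  shows "divdiffs u (\<lambda>x. \<Sum>i\<in>I. c i * f i x) = (\<lambda>x. \<Sum>i\<in>I. c i * divdiffs u (f i) x)"
  using assms
proof induction
  case empty
  then show ?case by (simp add: divdiffs_zero)
next
  case (insert i I)
  then show ?case using divdiffs_lin[of u "c i" "f i" 1 "\<lambda>x. \<Sum>i\<in>I. c i * f i x"] by simp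
qed

lemma deg_lessD: "\<lbrakk>deg_less k f; set u \<subseteq> S; length u = k; x \<in> carrier W\<rbrakk> \<Longrightarrow> divdiffs u f x = 0"
  by (simp add: deg_less_def)

lemma deg_less_cong: "(\<And>x. x \<in> carrier W \<Longrightarrow> f x = g x) \<Longrightarrow> deg_less k f = deg_less k g"
  unfolding deg_less_def using divdiffs_cong[of _ _ f g] by auto

lemma deg_less_0: "deg_less 0 f \<longleftrightarrow> (\<forall>x\<in>carrier W. f x = 0)"
  by (auto simp: deg_less_def)

lemma deg_less_Suc: "deg_less (Suc k) f \<longleftrightarrow> (\<forall>s\<in>S. deg_less k (divdiff s f))"
proof
  assume L: "deg_less (Suc k) f"
  show "\<forall>s\<in>S. deg_less k (divdiff s f)"
    unfolding deg_less_def[of k]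
  proof (intro ballI allI impI)
    fix s u x assume "s \<in> S" "set u \<subseteq> S" "length u = k" "x \<in> carrier W"
    then show "divdiffs u (divdiff s f) x = 0" using deg_lessD[OF L, of "u @ [s]" x] by simp
  qed
next
  assume R: "\<forall>s\<in>S. deg_less k (divdiff s f)"
  show "deg_less (Suc k) f"
    unfolding deg_less_def[of "Suc k"]
  proof (intro allI impI)
    fix u x assume u: "set u \<subseteq> S" "length u = Suc k" "x \<in> carrier W"
    then obtain v s where "u = v @ [s]" by (metis length_0_conv nat.distinct(1) rev_exhaust)
    then show "divdiffs u f x = 0" using u R deg_lessD[of k "divdiff s f" v x] by simp
  qed
qed

lemma deg_less_mono:
  assumes "deg_less k f" "k \<le> n"
  shows "deg_less n f"
proof -
  have "deg_less (Suc k) f" if "deg_less k f" for k f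
    using that
  proof (induction k arbitrary: f)
    case 0
    then show ?case by (auto simp: deg_less_Suc deg_less_0 divdiff_def)
  next
    case (Suc k)
    then show ?case using deg_less_Suc by blast
  qed
  with assms(2,1) show ?thesis by (induction rule: dec_induct) auto
qed

lemma deg_less_lin:
  "\<lbrakk>deg_less k f; deg_less k g\<rbrakk> \<Longrightarrow> deg_less k (\<lambda>x. a * f x + b * g x)"
  by (simp add: deg_less_def divdiffs_lin)

lemma deg_less_sum:
  assumes "finite I" "\<And>i. i \<in> I \<Longrightarrow> c i \<noteq> 0 \<Longrightarrow> deg_less k (f i)"
  shows "deg_less k (\<lambda>x. \<Sum>i\<in>I. c i * f i x)"
  unfolding deg_less_def divdiffs_sum[OF assms(1)]
proof (intro allI impI sum.neutral ballI)
  fix u x i assume "set u \<subseteq> S" "length u = k" "x \<in> carrier W" "i \<in> I"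
  then show "c i * divdiffs u (f i) x = 0"
    using assms(2)[of i] deg_lessD[of k "f i" u x] by (cases "c i = 0") auto
qed

lemma deg_less_const: "deg_less (Suc 0) (\<lambda>x. c)"
  by (simp add: deg_less_Suc deg_less_0 divdiff_def)

text \<open>
  The twisted Leibniz rule. Multiplication by a linear form commutes with a divided difference
  up to the reflection of the form and up to a scalar, which is what makes the form raise the
  degree by only one.
\<close>

lemma divdiff_linear_form:
  assumes "s \<in> S" "x \<in> carrier W"
  shows "divdiff s (\<lambda>x. \<phi> (act x v) * f x) x = \<phi> (act x (reflect s v)) * divdiff s f x + 2 * pair s v * f x"
proof -
  have "reflect s v = (\<lambda>r. 1 * v r + (- 2 * pair s v) * simple_root s r)"
    by (simp add: reflect_def)
  then have *: "\<phi> (act x v) = \<phi> (act x (reflect s v)) + 2 * pair s v * root_val s x"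
    using act_lin[OF assms(2), of 1 v "- 2 * pair s v" "simple_root s"]
      phi_lin[of 1 "act x v" "- 2 * pair s v" "act x (simple_root s)"] by (simp add: root_val_def)
  have "\<phi> (act (x \<otimes> s) v) = \<phi> (act x (reflect s v))" using assms by (simp add: act_mult)
  then show ?thesis using root_val_nonzero[OF assms] unfolding divdiff_def * by (simp add: field_simps)
qed

lemma deg_less_linear_form:
  "deg_less k f \<Longrightarrow> deg_less (Suc k) (\<lambda>x. \<phi> (act x v) * f x)"
proof (induction k arbitrary: f v)
  case 0
  then have "deg_less 0 (\<lambda>x. \<phi> (act x v) * f x)" by (simp add: deg_less_0)
  then show ?case using deg_less_mono by blast
next
  case (Suc k)
  show ?case
    unfolding deg_less_Suc[of "Suc k"]
  proof
    fix s assume s: "s \<in> S"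
    have "deg_less (Suc k) (\<lambda>x. \<phi> (act x (reflect s v)) * divdiff s f x)"
      using Suc.IH Suc.prems s deg_less_Suc by blast
    then have "deg_less (Suc k) (\<lambda>x. 1 * (\<phi> (act x (reflect s v)) * divdiff s f x) + (2 * pair s v) * f x)"
      using Suc.prems by (rule deg_less_lin)
    then show "deg_less (Suc k) (divdiff s (\<lambda>x. \<phi> (act x v) * f x))"
      using divdiff_linear_form[OF s, of _ v f] by (subst deg_less_cong) auto
  qed
qed

text \<open>
  Both the delta functions and the product of the positive roots are obtained as products of
  affine functions.
\<close>

lemma deg_less_prod:
  assumes "finite I"
  shows "deg_less (Suc (card I)) (\<lambda>x. \<Prod>i\<in>I. \<phi> (act x (v i)) - c i)"
  using assms
proof induction
  case empty
  then show ?case using deg_less_const by simp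
next
  case (insert i I)
  define P where "P x = (\<Prod>i\<in>I. \<phi> (act x (v i)) - c i)" for x
  have P: "deg_less (Suc (card I)) P" using insert by (simp add: P_def[abs_def])
  then have "deg_less (Suc (Suc (card I))) (\<lambda>x. 1 * (\<phi> (act x (v i)) * P x) + (- c i) * P x)"
    by (intro deg_less_lin deg_less_linear_form) (auto intro: deg_less_mono)
  then show ?case using insert by (simp add: P_def algebra_simps)
qed

definition delta :: "'a \<Rightarrow> 'a \<Rightarrow> real" where
  "delta y = (\<lambda>x. if x = y then 1 else 0)"

lemma delta_expand:
  "x \<in> carrier W \<Longrightarrow> (\<Sum>y\<in>carrier W. f y * delta y x) = f x"
  using fin by (simp add: delta_def if_distrib[of "\<lambda>t. _ * t"] sum.delta' cong: if_cong)

text \<open>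
  A right descent \<open>s\<close> of \<open>x y\<^sup>-\<^sup>1\<close> gives a vector \<open>y\<^sup>-\<^sup>1 \<alpha>\<^sub>s\<close> that \<open>x\<close> maps to a negative root,
  and \<open>y\<close> to the positive root \<open>\<alpha>\<^sub>s\<close>.
\<close>

lemma phi_separates:
  assumes "x \<in> carrier W" "y \<in> carrier W" "x \<noteq> y"
  obtains v where "\<phi> (act x v) \<noteq> \<phi> (act y v)"
proof -
  have "x \<otimes> inv y \<noteq> \<one>" using assms by (metis inv_closed inv_equality inv_inv)
  then obtain s where s: "s \<in> S" "len (x \<otimes> inv y \<otimes> s) < len (x \<otimes> inv y)"
    using ex_descent assms by (metis inv_closed m_closed)
  have "\<phi> (act (x \<otimes> inv y) (simple_root s)) < 0"
    using phi_neg act_root_neg s assms by simp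
  moreover have "\<phi> (simple_root s) > 0" using phi_pos root_pos s by blast
  moreover have "act x (act (inv y) (simple_root s)) = act (x \<otimes> inv y) (simple_root s)"
    "act y (act (inv y) (simple_root s)) = simple_root s"
    using assms by (simp_all add: act_mult act_act_inv)
  ultimately show ?thesis using that[of "act (inv y) (simple_root s)"] by simp
qed

text \<open>
  By interpolation: for each other point take an affine function that vanishes there and not at
  \<open>y\<close>. The resulting bound on the degree is crude; \<open>deg_less_top\<close> improves it to the optimal
  one.
\<close>

lemma deg_less_delta:
  assumes y: "y \<in> carrier W"
  shows "deg_less (card (carrier W)) (delta y)"
proof -
  have "\<forall>w. \<exists>v. w \<in> carrier W - {y} \<longrightarrow> \<phi> (act w v) \<noteq> \<phi> (act y v)"
    using phi_separates y by (metis DiffE singletonI)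
  then obtain v where v: "\<And>w. w \<in> carrier W - {y} \<Longrightarrow> \<phi> (act w (v w)) \<noteq> \<phi> (act y (v w))"
    by metis
  define I where "I = carrier W - {y}"
  define P where "P x = (\<Prod>w\<in>I. \<phi> (act x (v w)) - \<phi> (act w (v w)))" for x
  have I: "finite I" "Suc (card I) = card (carrier W)"
    using fin card_Suc_Diff1[OF fin y] by (simp_all only: I_def finite_Diff)
  have "P y \<noteq> 0"
  proof
    assume "P y = 0"
    then obtain w where "w \<in> I" "\<phi> (act y (v w)) - \<phi> (act w (v w)) = 0"
      unfolding P_def prod_zero_iff[OF I(1)] by blast
    then show False using v[of w] by (simp add: I_def)
  qed
  moreover have "P x = 0" if "x \<in> carrier W" "x \<noteq> y" for x
    using that I unfolding P_def by (intro prod_zero) (auto simp: I_def)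
  ultimately have "\<And>x. x \<in> carrier W \<Longrightarrow> delta y x = (1 / P y) * P x + 0 * P x"
    by (auto simp: delta_def)
  moreover have "deg_less (card (carrier W)) P"
    using deg_less_prod[OF I(1), of v "\<lambda>w. \<phi> (act w (v w))"] I by (simp add: P_def[abs_def])
  then have "deg_less (card (carrier W)) (\<lambda>x. (1 / P y) * P x + 0 * P x)"
    by (intro deg_less_lin)
  ultimately show ?thesis by (subst deg_less_cong) auto
qed

lemma deg_less_card: "deg_less (card (carrier W)) f"
proof -
  have "deg_less (card (carrier W)) (\<lambda>x. \<Sum>y\<in>carrier W. f y * delta y x)"
    using fin deg_less_delta by (intro deg_less_sum) auto
  then show ?thesis using delta_expand[of _ f] by (subst deg_less_cong) auto
qed

lemma divdiffs_expand:
  assumes "set b \<subseteq> S" "x \<in> carrier W"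
  shows "divdiffs b f x = (\<Sum>y\<in>carrier W. f y * divdiffs b (delta y) x)"
proof -
  have "divdiffs b f x = divdiffs b (\<lambda>x. \<Sum>y\<in>carrier W. f y * delta y x) x"
    using assms by (intro divdiffs_cong) (auto simp: delta_expand)
  then show ?thesis using divdiffs_sum[OF fin, of b f delta] by simp
qed

lemma character_values:
  fixes h :: "'a \<Rightarrow> real"
  assumes h: "\<And>y s. \<lbrakk>y \<in> carrier W; s \<in> S\<rbrakk> \<Longrightarrow> h (y \<otimes> s) = \<epsilon> * h y"
  shows "y \<in> carrier W \<Longrightarrow> h y = \<epsilon> ^ len y * h \<one>"
proof (induction "len y" arbitrary: y)
  case 0
  then show ?case by (simp add: len_0_iff)
next
  case (Suc n)
  then have "y \<noteq> \<one>" by auto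
  then obtain s where s: "s \<in> S" "len (y \<otimes> s) < len y" using ex_descent Suc.prems by blast
  then have n: "n = len (y \<otimes> s)" using len_mult_gen_cases[of y s] Suc by auto
  have "h y = \<epsilon> * h (y \<otimes> s)" using h[of "y \<otimes> s" s] s Suc.prems by simp
  also have "h (y \<otimes> s) = \<epsilon> ^ n * h \<one>" using Suc.hyps(1)[OF n] s Suc.prems n by simp
  finally show ?case by (simp flip: Suc.hyps(2))
qed

text \<open>
  When one more divided difference would kill everything, the functional \<open>f \<mapsto> (\<partial>\<^sub>b f) x\<close> is a
  multiple of \<open>f \<mapsto> \<Sum> (-1)\<^sup>l\<^sup>(\<^sup>y\<^sup>) f y\<close>: it vanishes on the image of each \<open>\<partial>\<^sub>s\<close>, and this image
  contains the sum of the delta functions at \<open>y\<close> and \<open>y s\<close>.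
\<close>

lemma top_coefficient_sign:
  assumes b: "set b \<subseteq> S" and x: "x \<in> carrier W"
    and top: "\<And>s f. s \<in> S \<Longrightarrow> divdiffs (b @ [s]) f x = 0"
    and y: "y \<in> carrier W"
  shows "divdiffs b (delta y) x = (-1) ^ len y * divdiffs b (delta \<one>) x"
proof (rule character_values[of "\<lambda>y. divdiffs b (delta y) x", OF _ y])
  fix y s assume y: "y \<in> carrier W" and s: "s \<in> S"
  have ne: "y \<otimes> s \<noteq> y" using len_mult_gen_neq[OF y s] by auto
  have "divdiff s (\<lambda>z. root_val s y * delta y z) z = 1 * delta y z + 1 * delta (y \<otimes> s) z"
    if z: "z \<in> carrier W" for z
  proof -
    have "z \<otimes> s = y \<longleftrightarrow> z = y \<otimes> s" using y z s by auto
    then show ?thesis using ne root_val_nonzero[OF s y] root_val_mult_gen[OF s y] by (auto simp: divdiff_def delta_def)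
  qed
  then have "divdiffs b (divdiff s (\<lambda>z. root_val s y * delta y z)) x
      = divdiffs b (\<lambda>z. 1 * delta y z + 1 * delta (y \<otimes> s) z) x"
    using b x by (intro divdiffs_cong) auto
  also have "\<dots> = divdiffs b (delta y) x + divdiffs b (delta (y \<otimes> s)) x"
    unfolding divdiffs_lin by simp
  finally show "divdiffs b (delta (y \<otimes> s)) x = (-1) * divdiffs b (delta y) x"
    using top[OF s, of "\<lambda>z. root_val s y * delta y z"] by simp
qed

section \<open>Vanishing above the length of the longest element\<close>

definition vandermonde :: "'a \<Rightarrow> real" where
  "vandermonde x = (\<Prod>\<beta>\<in>pos_roots. \<phi> (act x \<beta>))"

text \<open>
  A simple reflection changes the sign of its own root and permutes the other positive roots.
\<close>

lemma vandermonde_mult_gen: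
  assumes x: "x \<in> carrier W" and s: "s \<in> S"
  shows "vandermonde (x \<otimes> s) = - vandermonde x"
proof -
  define R where "R = pos_roots - {simple_root s}"
  have pr: "pos_roots = insert (simple_root s) R" "simple_root s \<notin> R" "finite R"
    using root_pos s finite_pos_roots by (auto simp: R_def)
  have ns: "reflect s \<beta> \<noteq> simple_root s" if "\<beta> \<in> R" for \<beta>
  proof
    assume "reflect s \<beta> = simple_root s"
    then have "reflect s (reflect s \<beta>) = (\<lambda>r. - simple_root s r)" using reflect_self[OF s] by simp
    then have "\<beta> = (\<lambda>r. - simple_root s r)" by (simp only: reflect_reflect[OF s])
    then show False using that uminus_pos_roots[OF root_pos[OF s]] by (simp add: R_def)
  qed
  have maps: "reflect s \<beta> \<in> R" if "\<beta> \<in> R" for \<beta>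
    using reflect_pos_roots[OF s, of \<beta>] ns[OF that] that by (simp add: R_def)
  have bij: "bij_betw (reflect s) R R"
    by (rule bij_betw_byWitness[where f' = "reflect s"]) (use maps in \<open>auto simp: reflect_reflect[OF s]\<close>)
  have "vandermonde (x \<otimes> s) = \<phi> (act x (reflect s (simple_root s))) * (\<Prod>\<beta>\<in>R. \<phi> (act x (reflect s \<beta>)))"
    using pr x s by (simp add: vandermonde_def act_mult)
  also have "(\<Prod>\<beta>\<in>R. \<phi> (act x (reflect s \<beta>))) = (\<Prod>\<beta>\<in>R. \<phi> (act x \<beta>))"
    by (rule prod.reindex_bij_betw[OF bij])
  also have "\<phi> (act x (reflect s (simple_root s))) = - \<phi> (act x (simple_root s))"
    using s by (simp add: reflect_self act_uminus phi_uminus)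
  finally show ?thesis using pr by (simp add: vandermonde_def)
qed

lemma vandermonde_one: "vandermonde \<one> \<noteq> 0"
proof -
  have "vandermonde \<one> = (\<Prod>\<beta>\<in>pos_roots. \<phi> \<beta>)" by (simp add: vandermonde_def)
  also have "\<dots> > 0" by (rule prod_pos) (rule phi_pos)
  finally show ?thesis by simp
qed

lemma deg_less_vandermonde: "deg_less (Suc (len w0)) vandermonde"
  using deg_less_prod[OF finite_pos_roots, of "\<lambda>\<beta>. \<beta>" "\<lambda>\<beta>. 0"] by (simp add: vandermonde_def[abs_def] len_w0)

text \<open>
  Let \<open>n\<close> be least such that \<open>n\<close> divided differences always give zero. Any product of \<open>n - 1\<close> of
  them is a multiple of the alternating sum by \<open>top_coefficient_sign\<close>. The product of the
  positive roots is itself alternating, so the alternating sum of its values is not zero; but it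
  is a polynomial of degree \<open>N = l(w0)\<close>, so if \<open>n - 1 > N\<close> it is killed. Then all products of
  \<open>n - 1\<close> divided differences vanish, against the choice of \<open>n\<close>.
\<close>

theorem deg_less_top: "deg_less (Suc (len w0)) f"
proof -
  define n where "n = (LEAST n. \<forall>f. deg_less n f)"
  have n: "\<forall>f. deg_less n f"
    unfolding n_def by (rule LeastI[of _ "card (carrier W)"]) (simp add: deg_less_card)
  have "n \<le> Suc (len w0)"
  proof (rule ccontr)
    assume "\<not> ?thesis"
    then obtain k where k: "n = Suc k" "Suc (len w0) \<le> k" by (cases n) auto
    have "deg_less k f" for f
      unfolding deg_less_def
    proof (intro allI impI)
      fix b x assume b: "set b \<subseteq> S" "length b = k" and x: "x \<in> carrier W"
      define c where "c = divdiffs b (delta \<one>) x"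
      have "divdiffs (b @ [s]) f x = 0" if "s \<in> S" for s f
        by (rule deg_lessD[OF n[rule_format]]) (use b x k that in auto)
      then have coeff: "divdiffs b (delta y) x = (-1) ^ len y * c" if "y \<in> carrier W" for y
        unfolding c_def using that by (intro top_coefficient_sign[OF b(1) x])
      have "0 = divdiffs b vandermonde x"
        using deg_lessD[OF deg_less_mono[OF deg_less_vandermonde k(2)] b x] by simp
      also have "\<dots> = (\<Sum>y\<in>carrier W. vandermonde y * divdiffs b (delta y) x)"
        by (rule divdiffs_expand[OF b(1) x])
      also have "\<dots> = (\<Sum>y\<in>carrier W. vandermonde \<one> * c)"
      proof (rule sum.cong[OF HOL.refl])
        fix y assume y: "y \<in> carrier W"
        have "vandermonde y = (-1) ^ len y * vandermonde \<one>"
          by (rule character_values[of vandermonde, OF _ y]) (simp add: vandermonde_mult_gen)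
        then show "vandermonde y * divdiffs b (delta y) x = vandermonde \<one> * c"
          by (simp add: coeff[OF y] flip: power_add mult_2)
      qed
      finally have "real (card (carrier W)) * (vandermonde \<one> * c) = 0" by simp
      moreover have "carrier W \<noteq> {}" using one_closed by auto
      then have "card (carrier W) \<noteq> 0" using fin by simp
      ultimately have "c = 0" using vandermonde_one by simp
      then have "(\<Sum>y\<in>carrier W. f y * divdiffs b (delta y) x) = 0"
        by (intro sum.neutral) (simp add: coeff)
      then show "divdiffs b f x = 0" using divdiffs_expand[OF b(1) x, of f] by (rule HOL.trans[rotated])
    qed
    then have "n \<le> k" unfolding n_def by (intro Least_le allI)
    then show False using k by simp
  qed
  then show ?thesis using n deg_less_mono by blast
qed

section \<open>Reduced words and the degree criterion\<close>

lemma divdiffs_delta_support: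
  assumes "set b \<subseteq> S" "x \<in> carrier W" "z \<in> carrier W" "divdiffs b (delta (x \<otimes> z)) x \<noteq> 0"
  shows "len z < length b \<or> z = wp b"
  using assms
proof (induction b arbitrary: x z)
  case Nil
  then have "x \<otimes> z = x" by (auto simp: delta_def split: if_splits)
  then show ?case using Nil.prems by (simp add: r_cancel_one)
next
  case (Cons s b)
  then have s: "s \<in> S" "set b \<subseteq> S" by auto
  have "divdiffs b (delta (x \<otimes> z)) x \<noteq> 0 \<or> divdiffs b (delta (x \<otimes> z)) (x \<otimes> s) \<noteq> 0"
    using Cons.prems by (auto simp: divdiff_def)
  then show ?case
  proof
    assume "divdiffs b (delta (x \<otimes> z)) x \<noteq> 0"
    then have "len z < length b \<or> z = wp b" using Cons.IH Cons.prems s by blast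
    then show ?thesis using len_wp_le[OF s(2)] by auto
  next
    assume *: "divdiffs b (delta (x \<otimes> z)) (x \<otimes> s) \<noteq> 0"
    have "x \<otimes> s \<otimes> (s \<otimes> z) = x \<otimes> z" using Cons.prems s by (simp add: m_assoc)
    with * have "len (s \<otimes> z) < length b \<or> s \<otimes> z = wp b"
      using Cons.IH[of "x \<otimes> s" "s \<otimes> z"] Cons.prems s by simp
    then show ?thesis
    proof
      assume "len (s \<otimes> z) < length b"
      moreover have "len (s \<otimes> (s \<otimes> z)) \<le> len s + len (s \<otimes> z)"
        by (rule len_mult_le) (use Cons.prems s in auto)
      ultimately show ?thesis using len_gen_le[OF s(1)] Cons.prems s by simp
    next
      assume "s \<otimes> z = wp b"
      then have "s \<otimes> (s \<otimes> z) = s \<otimes> wp b" by simp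
      then show ?thesis using Cons.prems s by simp
    qed
  qed
qed

lemma divdiffs_delta_top:
  assumes "set b \<subseteq> S" "x \<in> carrier W" "len (wp b) = length b"
  shows "divdiffs b (delta (x \<otimes> wp b)) x \<noteq> 0"
  using assms
proof (induction b arbitrary: x)
  case Nil
  then show ?case by (simp add: delta_def)
next
  case (Cons s b)
  then have s: "s \<in> S" "set b \<subseteq> S" "wp b \<in> carrier W" by auto
  have "len (s \<otimes> wp b) \<le> len s + len (wp b)" by (rule len_mult_le) (use s in auto)
  then have l: "len (wp b) = length b"
    using Cons.prems len_gen_le[OF s(1)] len_wp_le[OF s(2)] by simp
  have "divdiffs b (delta (x \<otimes> (s \<otimes> wp b))) x = 0"
  proof (rule ccontr)
    assume "\<not> ?thesis"
    then have "len (s \<otimes> wp b) < length b \<or> s \<otimes> wp b = wp b"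
      using divdiffs_delta_support Cons.prems s by (metis S_carrier m_closed)
    then show False using Cons.prems l by auto
  qed
  moreover have "divdiffs b (delta (x \<otimes> s \<otimes> wp b)) (x \<otimes> s) \<noteq> 0"
    using Cons.IH[of "x \<otimes> s"] Cons.prems s l by simp
  ultimately show ?case using Cons.prems s root_val_nonzero[of s x] by (simp add: divdiff_def m_assoc)
qed

definition reduced_choice :: "('a \<Rightarrow> 'a list) \<Rightarrow> bool" where
  "reduced_choice a \<longleftrightarrow>
    (\<forall>w\<in>carrier W. set (a w) \<subseteq> S \<and> wp (a w) = w \<and> length (a w) = len w)"

lemma reduced_choiceD:
  assumes "reduced_choice a" "w \<in> carrier W"
  shows "set (a w) \<subseteq> S" "wp (a w) = w" "length (a w) = len w"
  using assms by (auto simp: reduced_choice_def)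

text \<open>
  By the antisymmetry of the top coefficients it is the same to look at the coefficient of
  \<open>f w0\<close>. Only the full word can produce \<open>w0\<close>, since proper subwords are too short.
\<close>

lemma top_coefficient_nonzero_iff:
  assumes b: "set b \<subseteq> S" "length b = len w0"
  shows "divdiffs b (delta \<one>) \<one> \<noteq> 0 \<longleftrightarrow> wp b = w0"
proof -
  have "divdiffs (b @ [s]) f \<one> = 0" if "s \<in> S" for s f
    by (rule deg_lessD[OF deg_less_top]) (use b that in auto)
  then have "divdiffs b (delta w0) \<one> = (-1) ^ len w0 * divdiffs b (delta \<one>) \<one>"
    by (intro top_coefficient_sign[OF b(1)]) auto
  then have "divdiffs b (delta \<one>) \<one> \<noteq> 0 \<longleftrightarrow> divdiffs b (delta w0) \<one> \<noteq> 0" by simp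
  also have "\<dots> \<longleftrightarrow> wp b = w0"
  proof
    assume "divdiffs b (delta w0) \<one> \<noteq> 0"
    then have "len w0 < length b \<or> w0 = wp b"
      using divdiffs_delta_support[OF b(1), of \<one> w0] by simp
    then show "wp b = w0" using b by auto
  next
    assume "wp b = w0"
    then show "divdiffs b (delta w0) \<one> \<noteq> 0"
      using divdiffs_delta_top[OF b(1), of \<one>] b by simp
  qed
  finally show ?thesis .
qed

text \<open>
  The function attached to \<open>u\<close> lives on elements shorter than \<open>u\<close> and on \<open>u\<close> itself, so the
  functions form a triangular basis. The words of inverses are used because the letters multiply
  the argument on the right, and a point is carried to \<open>1\<close> by its inverse.
\<close>

lemma delta_cyclic:
  assumes a: "reduced_choice a"
  obtains c where
    "\<And>x. x \<in> carrier W \<Longrightarrow> f x = (\<Sum>u\<in>carrier W. c u * divdiffs (a (inv u)) (delta \<one>) x)"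
proof -
  define M where "M x u = divdiffs (a (inv u)) (delta \<one>) x" for x u
  have "\<exists>c. \<forall>x\<in>carrier W. (\<Sum>u\<in>carrier W. M x u * c u) = f x"
  proof (rule triangular_solve[OF fin, where r = "\<lambda>w. len w0 - len w"])
    fix u assume u: "u \<in> carrier W"
    then show "M u u \<noteq> 0"
      using divdiffs_delta_top[of "a (inv u)" u] reduced_choiceD[OF a, of "inv u"] by (simp add: M_def)
  next
    fix x u assume x: "x \<in> carrier W" and u: "u \<in> carrier W" and nz: "M x u \<noteq> 0"
    have "len (inv x) < length (a (inv u)) \<or> inv x = wp (a (inv u))"
      using divdiffs_delta_support[of "a (inv u)" x "inv x"] reduced_choiceD[OF a, of "inv u"] nz x u
      by (simp add: M_def)
    then have "len x < len u \<or> inv x = inv u"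
      using reduced_choiceD[OF a, of "inv u"] x u by simp
    then show "u = x \<or> len w0 - len u < len w0 - len x"
      using inv_inj x u len_le_w0[OF u] by (auto dest: inj_onD)
  qed
  then obtain c where c: "\<forall>x\<in>carrier W. (\<Sum>u\<in>carrier W. M x u * c u) = f x" by blast
  show ?thesis
    by (rule that[of c]) (use c in \<open>simp add: M_def mult.commute\<close>)
qed

text \<open>
  Expand \<open>f\<close> in the basis of \<open>delta_cyclic\<close>. The basis function of \<open>u\<close> is obtained by \<open>l(u)\<close>
  divided differences, so it has degree at most \<open>N - l(u)\<close>, and it suffices that no \<open>u\<close> with
  \<open>l(u) + k \<le> N\<close> occurs. Take a shortest such \<open>u\<close> that occurs and apply the functional of
  \<open>w = w0 u\<close>, whose length is \<open>N - l(u) \<ge> k\<close>. Longer basis functions are killed because more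
  than \<open>N\<close> divided differences are applied to the delta function, and among those of the same
  length only \<open>u\<close> completes the word of \<open>w\<close> to a reduced word of \<open>w0\<close>.
\<close>

theorem deg_less_criterion:
  assumes a: "reduced_choice a"
    and f: "\<And>w. \<lbrakk>w \<in> carrier W; k \<le> len w\<rbrakk> \<Longrightarrow> divdiffs (a w) f \<one> = 0"
  shows "deg_less k f"
proof -
  define N where "N = len w0"
  define g where "g u = divdiffs (a (inv u)) (delta \<one>)" for u
  obtain c where c: "\<And>x. x \<in> carrier W \<Longrightarrow> f x = (\<Sum>u\<in>carrier W. c u * g u x)"
    using delta_cyclic[OF a, of f] by (auto simp: g_def)
  have vanish: "c u = 0" if "u \<in> carrier W" "len u + k \<le> N" for u
    using that
  proof (induction "len u" arbitrary: u rule: less_induct)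
    case less
    define w where "w = w0 \<otimes> u"
    have w: "w \<in> carrier W" using less.prems by (simp add: w_def)
    have lw: "len w = N - len u" using len_w0_mult less.prems by (simp add: w_def N_def)
    have aw: "set (a w) \<subseteq> S" "wp (a w) = w" "length (a w) = len w"
      using reduced_choiceD[OF a w] by auto
    have "0 = divdiffs (a w) f \<one>" using f[OF w] lw less.prems by simp
    also have "\<dots> = divdiffs (a w) (\<lambda>x. \<Sum>v\<in>carrier W. c v * g v x) \<one>"
      by (rule divdiffs_cong) (use aw c in auto)
    also have "\<dots> = (\<Sum>v\<in>carrier W. c v * divdiffs (a w) (g v) \<one>)"
      unfolding divdiffs_sum[OF fin] ..
    also have "\<dots> = (\<Sum>v\<in>carrier W. if v = u then c u * divdiffs (a w) (g u) \<one> else 0)"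
    proof (rule sum.cong[OF HOL.refl])
      fix v assume v: "v \<in> carrier W"
      have av: "set (a (inv v)) \<subseteq> S" "wp (a (inv v)) = inv v" "length (a (inv v)) = len v"
        using reduced_choiceD[OF a, of "inv v"] v by auto
      have eq: "divdiffs (a w) (g v) \<one> = divdiffs (a w @ a (inv v)) (delta \<one>) \<one>" by (simp add: g_def)
      consider "len v < len u" | "v = u" | "len v = len u" "v \<noteq> u" | "len u < len v" by linarith
      then show "c v * divdiffs (a w) (g v) \<one> = (if v = u then c u * divdiffs (a w) (g u) \<one> else 0)"
      proof cases
        case 1
        then show ?thesis using less.hyps[of v] v less.prems by auto
      next
        case 3
        have "wp (a w @ a (inv v)) \<noteq> w0"
        proof
          assume "wp (a w @ a (inv v)) = w0"
          then have "w0 \<otimes> (u \<otimes> inv v) = w0 \<otimes> \<one>"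
            using aw av v less.prems by (simp add: w_def m_assoc)
          then have "u \<otimes> inv v = \<one>" using v less.prems by (subst (asm) l_cancel) auto
          then have "inv (inv v) = u" using v less.prems by (intro inv_equality) auto
          then show False using 3 v by simp
        qed
        then have "divdiffs (a w @ a (inv v)) (delta \<one>) \<one> = 0"
          using top_coefficient_nonzero_iff[of "a w @ a (inv v)"] aw av 3 lw less.prems
          by (auto simp: N_def)
        then show ?thesis using eq 3 by simp
      next
        case 4
        then have "deg_less (len w + len v) (delta \<one>)"
          using lw less.prems by (intro deg_less_mono[OF deg_less_top]) (simp add: N_def)
        then have "divdiffs (a w @ a (inv v)) (delta \<one>) \<one> = 0"
          by (rule deg_lessD) (use aw av in auto)
        then show ?thesis using eq 4 by auto
      qed simp
    qed
    also have "\<dots> = c u * divdiffs (a w) (g u) \<one>" using fin less.prems by simp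
    finally have "c u * divdiffs (a w) (g u) \<one> = 0" by simp
    moreover have "divdiffs (a w) (g u) \<one> \<noteq> 0"
    proof -
      have au: "set (a (inv u)) \<subseteq> S" "wp (a (inv u)) = inv u" "length (a (inv u)) = len u"
        using reduced_choiceD[OF a, of "inv u"] less.prems by auto
      have "wp (a w @ a (inv u)) = w0" using aw au less.prems by (simp add: w_def m_assoc)
      then have "divdiffs (a w @ a (inv u)) (delta \<one>) \<one> \<noteq> 0"
        using top_coefficient_nonzero_iff[of "a w @ a (inv u)"] aw au lw less.prems
        by (simp add: N_def)
      then show ?thesis by (simp add: g_def)
    qed
    ultimately show ?case by simp
  qed
  have "deg_less k (\<lambda>x. \<Sum>u\<in>carrier W. c u * g u x)"
  proof (rule deg_less_sum[OF fin])
    fix u assume u: "u \<in> carrier W" "c u \<noteq> 0"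
    show "deg_less k (g u)"
      unfolding deg_less_def
    proof (intro allI impI)
      fix b x assume b: "set b \<subseteq> S" "length b = k" and x: "x \<in> carrier W"
      have au: "set (a (inv u)) \<subseteq> S" "length (a (inv u)) = len u"
        using reduced_choiceD[OF a, of "inv u"] u by auto
      have "N < len u + k" using vanish u by (meson not_less)
      then have "deg_less (k + len u) (delta \<one>)"
        by (intro deg_less_mono[OF deg_less_top]) (simp add: N_def)
      then have "divdiffs (b @ a (inv u)) (delta \<one>) x = 0"
        by (rule deg_lessD) (use au b x in auto)
      then show "divdiffs b (g u) x = 0" by (simp add: g_def)
    qed
  qed
  then show ?thesis using deg_less_cong[of f "\<lambda>x. \<Sum>u\<in>carrier W. c u * g u x"] c by simp
qed

lemma divdiff_w0:
  assumes "s \<in> S" "x \<in> carrier W"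
  shows "divdiff s (\<lambda>x. f (w0 \<otimes> x)) x = - divdiff s f (w0 \<otimes> x)"
  using assms by (simp add: divdiff_def root_val_w0 m_assoc)

text \<open>
  Divided differences anticommute with the translation by \<open>w0\<close>, because \<open>\<phi>\<close> is odd, and
  functions of degree \<open>0\<close> are constant.
\<close>

lemma w0_on_graded_piece:
  "deg_less (Suc k) f \<Longrightarrow> deg_less k (\<lambda>x. 1 * f (w0 \<otimes> x) + (- ((-1) ^ k)) * f x)"
proof (induction k arbitrary: f)
  case 0
  have "f (y \<otimes> s) = 1 * f y" if "y \<in> carrier W" "s \<in> S" for y s
  proof -
    have "divdiff s f y = 0" using 0 that by (simp add: deg_less_Suc deg_less_0)
    then show ?thesis using root_val_nonzero[OF that(2,1)] by (simp add: divdiff_def)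
  qed
  then have const: "f x = 1 ^ len x * f \<one>" if "x \<in> carrier W" for x
    using that by (rule character_values)
  have "f (w0 \<otimes> x) = f x" if "x \<in> carrier W" for x
    using const[OF that] const[OF m_closed[OF w0_closed that]] by (simp only: power_one)
  then show ?case by (simp add: deg_less_0)
next
  case (Suc k)
  show ?case
    unfolding deg_less_Suc[of k]
  proof
    fix s assume s: "s \<in> S"
    define h where "h = (\<lambda>x. 1 * divdiff s f (w0 \<otimes> x) + (- ((-1) ^ k)) * divdiff s f x)"
    have "deg_less k h" unfolding h_def using Suc.IH Suc.prems s deg_less_Suc by blast
    then have "deg_less k (\<lambda>x. (-1) * h x + 0 * h x)" by (intro deg_less_lin)
    moreover have "divdiff s (\<lambda>x. 1 * f (w0 \<otimes> x) + (- ((-1) ^ Suc k)) * f x) x = (-1) * h x + 0 * h x"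
      if "x \<in> carrier W" for x
      unfolding divdiff_lin divdiff_w0[OF s that] h_def by simp
    ultimately show "deg_less k (divdiff s (\<lambda>x. 1 * f (w0 \<otimes> x) + (- ((-1) ^ Suc k)) * f x))"
      by (subst deg_less_cong)
  qed
qed

section \<open>Cosets of a standard parabolic subgroup\<close>

lemma act_parabolic_coord:
  assumes "set u \<subseteq> J" "J \<subseteq> S" "r \<notin> J"
  shows "act_word u v r = v r"
  using assms(1) by (induction u) (use assms in \<open>auto simp: reflect_def simple_root_def\<close>)

text \<open>
  Otherwise \<open>v\<close> has a right descent \<open>s\<close>. It lies in \<open>J\<close>, since elements of \<open>W\<^sub>J\<close> change only
  coordinates in \<open>J\<close>. So \<open>v \<alpha>\<^sub>s\<close> is a nonpositive combination of the simple roots in \<open>J\<close>, which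
  \<open>x\<close> maps to positive roots; but \<open>x v\<close> has to map \<open>\<alpha>\<^sub>s\<close> to a positive root.
\<close>

lemma coset_rep_unique:
  assumes J: "J \<subseteq> S"
    and x: "x \<in> left_coset_reps W S J" and v: "v \<in> generate W J"
    and xv: "x \<otimes> v \<in> left_coset_reps W S J"
  shows "v = \<one>"
proof (rule ccontr)
  assume ne: "v \<noteq> \<one>"
  obtain u where u: "set u \<subseteq> J" "wp u = v" using generate_words[OF J v] by blast
  then have uS: "set u \<subseteq> S" using J by auto
  then have vW: "v \<in> carrier W" using u by auto
  have xW: "x \<in> carrier W" using x by (simp add: left_coset_reps_def)
  obtain s where s: "s \<in> S" "len (v \<otimes> s) < len v" using ex_descent[OF vW ne] .
  define \<beta> where "\<beta> = act v (simple_root s)"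
  have \<beta>u: "\<beta> = act_word u (simple_root s)" using u uS by (auto simp: \<beta>_def)
  have "(\<lambda>r. - \<beta> r) \<in> pos_roots" unfolding \<beta>_def by (rule act_root_neg[OF vW s])
  then have neg: "\<beta> r \<le> 0" for r by (auto simp: pos_roots_def)
  have off: "\<beta> r = simple_root s r" if "r \<notin> J" for r
    unfolding \<beta>u by (rule act_parabolic_coord[OF u(1) J that])
  have sJ: "s \<in> J"
  proof (rule ccontr)
    assume "s \<notin> J"
    then show False using off[of s] neg[of s] by (simp add: simple_root_def)
  qed
  have "act (x \<otimes> v) (simple_root s) \<in> pos_roots"
    using xv sJ s(1) by (intro act_root_pos) (auto simp: left_coset_reps_def)
  moreover have "act (x \<otimes> v) (simple_root s) = (\<lambda>t. \<Sum>r\<in>S. \<beta> r * act x (simple_root r) t)"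
    unfolding act_mult[OF xW vW] \<beta>_def[symmetric]
    by (rule act_root_expand) (use act_root_in_roots[OF vW s(1)] roots_supp in \<open>simp add: \<beta>_def\<close>)
  moreover have "(\<Sum>r\<in>S. \<beta> r * act x (simple_root r) t) \<le> 0" for t
  proof (rule sum_nonpos)
    fix r assume r: "r \<in> S"
    show "\<beta> r * act x (simple_root r) t \<le> 0"
    proof (cases "r \<in> J")
      case True
      then have "act x (simple_root r) t \<ge> 0"
        using x r by (intro root_nonneg) (auto simp: left_coset_reps_def)
      then show ?thesis using neg[of r] by (simp add: mult_nonpos_nonneg)
    next
      case False
      then have "r \<noteq> s" using sJ by auto
      then show ?thesis using off[OF False] by (simp add: simple_root_def)
    qed
  qed
  ultimately have "act (x \<otimes> v) (simple_root s) \<in> pos_roots" "height (act (x \<otimes> v) (simple_root s)) \<le> 0"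
    by (auto simp: height_def intro: sum_nonpos)
  then show False using height_pos by fastforce
qed

context
  fixes J
  assumes J: "J \<subseteq> S"
begin

text \<open>
  Equality of the left cosets of \<open>x\<close> and \<open>y\<close>, see \<open>coset_eq_iff\<close>.
\<close>

definition coset_eq :: "'a \<Rightarrow> 'a \<Rightarrow> bool" where
  "coset_eq x y \<longleftrightarrow> inv x \<otimes> y \<in> generate W J"

definition invariant :: "('a \<Rightarrow> real) \<Rightarrow> bool" where
  "invariant f \<longleftrightarrow> (\<forall>x\<in>carrier W. \<forall>s\<in>J. f (x \<otimes> s) = f x)"

lemma parabolic: "subgroup (generate W J) W"
  using J by (intro generate_is_subgroup) auto

lemma coset_eq_refl: "x \<in> carrier W \<Longrightarrow> coset_eq x x"
  using subgroup.one_closed[OF parabolic] by (simp add: coset_eq_def)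

lemma coset_eq_sym:
  assumes "x \<in> carrier W" "y \<in> carrier W" "coset_eq x y"
  shows "coset_eq y x"
  using subgroup.m_inv_closed[OF parabolic, of "inv x \<otimes> y"] assms
  by (simp add: coset_eq_def inv_mult_group)

lemma coset_eq_trans:
  assumes "x \<in> carrier W" "y \<in> carrier W" "z \<in> carrier W" "coset_eq x y" "coset_eq y z"
  shows "coset_eq x z"
proof -
  have "(inv x \<otimes> y) \<otimes> (inv y \<otimes> z) \<in> generate W J"
    using assms subgroup.m_closed[OF parabolic] by (simp add: coset_eq_def)
  moreover have "(inv x \<otimes> y) \<otimes> (inv y \<otimes> z) = inv x \<otimes> (y \<otimes> inv y) \<otimes> z"
    using assms(1-3) by (simp only: m_assoc m_closed inv_closed)
  ultimately show ?thesis using assms(1-3) by (simp add: coset_eq_def)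
qed

lemma coset_eq_gen:
  assumes "x \<in> carrier W" "s \<in> J"
  shows "coset_eq x (x \<otimes> s)"
proof -
  have "inv x \<otimes> (x \<otimes> s) = s" using assms J by (simp add: subsetD flip: m_assoc)
  then show ?thesis using assms generate.incl by (auto simp: coset_eq_def)
qed

lemma coset_eq_iff:
  assumes x: "x \<in> carrier W" and y: "y \<in> carrier W"
  shows "y <#\<^bsub>W\<^esub> generate W J = x <#\<^bsub>W\<^esub> generate W J \<longleftrightarrow> coset_eq x y"
proof
  assume eq: "y <#\<^bsub>W\<^esub> generate W J = x <#\<^bsub>W\<^esub> generate W J"
  have "y \<in> y <#\<^bsub>W\<^esub> generate W J"
    using y subgroup.one_closed[OF parabolic] by (force simp: l_coset_def)
  then obtain h where h: "h \<in> generate W J" "y = x \<otimes> h" using eq by (auto simp: l_coset_def)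
  then have "inv x \<otimes> y = h"
    using x subgroup.mem_carrier[OF parabolic h(1)] by (simp flip: m_assoc)
  then show "coset_eq x y" using h by (simp add: coset_eq_def)
next
  assume "coset_eq x y"
  moreover have "y = x \<otimes> (inv x \<otimes> y)" using x y by (simp flip: m_assoc)
  ultimately have "y \<in> x <#\<^bsub>W\<^esub> generate W J" by (auto simp: coset_eq_def l_coset_def)
  then show "y <#\<^bsub>W\<^esub> generate W J = x <#\<^bsub>W\<^esub> generate W J"
    using l_repr_independence[OF _ x parabolic] by simp
qed

abbreviation reps where "reps \<equiv> left_coset_reps W S J"

lemma reps_carrier: "w \<in> reps \<Longrightarrow> w \<in> carrier W" by (simp add: left_coset_reps_def)

lemma finite_reps: "finite reps" using fin by (simp add: left_coset_reps_def)

lemma reps_unique: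
  assumes "w \<in> reps" "w' \<in> reps" "coset_eq w w'"
  shows "w = w'"
proof -
  have c: "w \<in> carrier W" "w' \<in> carrier W" using assms reps_carrier by auto
  then have eq: "w \<otimes> (inv w \<otimes> w') = w'" by (simp flip: m_assoc)
  then have "inv w \<otimes> w' = \<one>"
    using coset_rep_unique[OF J assms(1), of "inv w \<otimes> w'"] assms by (simp add: coset_eq_def)
  then show ?thesis using eq c by simp
qed

lemma reps_exists_minimal:
  assumes x: "x \<in> carrier W"
  obtains w where "w \<in> reps" "coset_eq w x" "len w \<le> len x"
proof -
  define P where "P y \<longleftrightarrow> y \<in> carrier W \<and> coset_eq y x" for y
  have "P x" using x coset_eq_refl by (simp add: P_def)
  then obtain w where w: "P w" "\<And>y. P y \<Longrightarrow> len w \<le> len y"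
    using ex_has_least_nat[of P x len] by blast
  have "len w < len (w \<otimes> s)" if s: "s \<in> J" for s
  proof -
    have sS: "s \<in> S" using s J by auto
    then have "P (w \<otimes> s)"
      using w(1) s x coset_eq_trans[of "w \<otimes> s" w x] coset_eq_sym[OF _ _ coset_eq_gen, of w s]
      by (auto simp: P_def)
    then have "len w \<le> len (w \<otimes> s)" by (rule w(2))
    moreover have "len (w \<otimes> s) \<noteq> len w" using w(1) sS by (intro len_mult_gen_neq) (auto simp: P_def)
    ultimately show ?thesis by simp
  qed
  then have "w \<in> reps" using w(1) by (simp add: left_coset_reps_def P_def)
  then show ?thesis using that w \<open>P x\<close> by (auto simp: P_def)
qed

lemma reps_minimal:
  assumes "w \<in> reps" "y \<in> carrier W" "coset_eq w y"
  shows "len w \<le> len y"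
proof -
  obtain w' where w': "w' \<in> reps" "coset_eq w' y" "len w' \<le> len y"
    using reps_exists_minimal[OF assms(2)] by blast
  then have "coset_eq w w'"
    using coset_eq_trans[of w y w'] coset_eq_sym[of w' y] assms reps_carrier by auto
  then show ?thesis using reps_unique assms w' by blast
qed

text \<open>
  With these words the functional of \<open>w \<notin> X\<^sub>J\<close> first applies a divided difference along a letter
  of \<open>J\<close>, which kills the functions that are constant on cosets.
\<close>

lemma adapted_reduced_choice:
  obtains a where "reduced_choice a"
    "\<And>w. \<lbrakk>w \<in> carrier W; w \<notin> reps\<rbrakk> \<Longrightarrow> \<exists>v s. s \<in> J \<and> a w = v @ [s]"
proof -
  have "\<exists>u. w \<in> carrier W \<longrightarrow> (set u \<subseteq> S \<and> wp u = w \<and> length u = len w)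
      \<and> (w \<notin> reps \<longrightarrow> (\<exists>v s. s \<in> J \<and> u = v @ [s]))" for w
  proof (cases "w \<in> carrier W \<and> w \<notin> reps")
    case True
    then obtain s where s: "s \<in> J" "\<not> len w < len (w \<otimes> s)" by (auto simp: left_coset_reps_def)
    have sS: "s \<in> S" using s J by auto
    obtain v where v: "set v \<subseteq> S" "wp v = w \<otimes> s" "length v = len (w \<otimes> s)"
      using ex_reduced_word[of "w \<otimes> s"] True sS by auto
    have "length (v @ [s]) = len w" using v s True len_mult_gen_cases[of w s] sS by auto
    then show ?thesis using v s sS True by (intro exI[of _ "v @ [s]"]) auto
  next
    case False
    show ?thesis
    proof (cases "w \<in> carrier W")
      case True
      then obtain u where "set u \<subseteq> S" "wp u = w" "length u = len w" using ex_reduced_word by blast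
      then show ?thesis using False by blast
    qed simp
  qed
  then obtain a where "\<And>w. w \<in> carrier W \<longrightarrow> (set (a w) \<subseteq> S \<and> wp (a w) = w \<and> length (a w) = len w)
      \<and> (w \<notin> reps \<longrightarrow> (\<exists>v s. s \<in> J \<and> a w = v @ [s]))" by metis
  then show ?thesis by (intro that[of a]) (auto simp: reduced_choice_def)
qed

lemma invariant_coset_eq:
  assumes f: "invariant f" and x: "x \<in> carrier W" and y: "y \<in> carrier W" and xy: "coset_eq x y"
  shows "f y = f x"
proof -
  obtain u where u: "set u \<subseteq> J" "wp u = inv x \<otimes> y"
    using generate_words[OF J] xy by (auto simp: coset_eq_def)
  have "f (x \<otimes> wp u) = f x"
    using u(1) x
  proof (induction u arbitrary: x)
    case (Cons s u)
    then have s: "s \<in> J" "s \<in> S" "set u \<subseteq> S" using J by auto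
    have "f (x \<otimes> wp (s # u)) = f (x \<otimes> s \<otimes> wp u)" using Cons.prems s by (simp add: m_assoc)
    also have "\<dots> = f (x \<otimes> s)" using Cons s by simp
    also have "\<dots> = f x" using f Cons.prems s by (simp add: invariant_def)
    finally show ?case .
  qed simp
  moreover have "x \<otimes> (inv x \<otimes> y) = y" using x y by (simp flip: m_assoc)
  ultimately show ?thesis using u by simp
qed

definition coset_ind :: "'a \<Rightarrow> 'a \<Rightarrow> real" where
  "coset_ind w = (\<lambda>x. if coset_eq w x then 1 else 0)"

lemma invariant_coset_ind:
  assumes w: "w \<in> carrier W"
  shows "invariant (coset_ind w)"
  unfolding invariant_def
proof (intro ballI)
  fix x s assume x: "x \<in> carrier W" and s: "s \<in> J"
  have xs: "x \<otimes> s \<in> carrier W" using x s J by auto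
  have "coset_eq w (x \<otimes> s) \<longleftrightarrow> coset_eq w x"
    using coset_eq_trans[OF w x xs] coset_eq_trans[OF w xs x] coset_eq_gen[OF x s]
      coset_eq_sym[OF x xs] by blast
  then show "coset_ind w (x \<otimes> s) = coset_ind w x" by (simp add: coset_ind_def)
qed

lemma invariant_expand:
  assumes f: "invariant f" and x: "x \<in> carrier W"
  shows "f x = (\<Sum>w\<in>reps. f w * coset_ind w x)"
proof -
  obtain w where w: "w \<in> reps" "coset_eq w x" using reps_exists_minimal[OF x] by blast
  have iff: "coset_eq w' x \<longleftrightarrow> w' = w" if w': "w' \<in> reps" for w'
  proof
    assume "coset_eq w' x"
    then have "coset_eq w' w"
      using coset_eq_trans[of w' x w] coset_eq_sym[of w x] w w' x reps_carrier by auto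
    then show "w' = w" using reps_unique w w' by blast
  qed (use w in simp)
  have "(\<Sum>v\<in>reps. f v * coset_ind v x) = (\<Sum>v\<in>reps. if v = w then f w else 0)"
    by (rule sum.cong) (auto simp: coset_ind_def iff)
  also have "\<dots> = f w" using w finite_reps by simp
  also have "\<dots> = f x" using invariant_coset_eq[OF f _ x w(2)] w reps_carrier by simp
  finally show ?thesis by simp
qed

lemma invariant_sum: "(\<And>i. i \<in> I \<Longrightarrow> invariant (f i)) \<Longrightarrow> invariant (\<lambda>x. \<Sum>i\<in>I. c i * f i x)"
  by (simp add: invariant_def)

lemma invariant_diff: "\<lbrakk>invariant f; invariant g\<rbrakk> \<Longrightarrow> invariant (\<lambda>x. f x - g x)"
  by (simp add: invariant_def)

section \<open>The trace of the longest element\<close>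

theorem sum_signs_eq_fixed_cosets:
  "(\<Sum>w\<in>reps. (-1 :: real) ^ len w) = card {w \<in> reps. coset_eq w (w0 \<otimes> w)}"
proof -
  obtain a where a: "reduced_choice a"
    and aJ: "\<And>w. \<lbrakk>w \<in> carrier W; w \<notin> reps\<rbrakk> \<Longrightarrow> \<exists>v s. s \<in> J \<and> a w = v @ [s]"
    using adapted_reduced_choice by blast
  note aw = reduced_choiceD[OF a]
  define L where "L w f = divdiffs (a w) f \<one>" for w f
  have L_sum: "L w (\<lambda>x. \<Sum>i\<in>I. c i * f i x) = (\<Sum>i\<in>I. c i * L w (f i))"
    if "finite I" for w c I and f :: "'a \<Rightarrow> 'a \<Rightarrow> real"
    unfolding L_def divdiffs_sum[OF that] ..
  have L_lin: "L w (\<lambda>x. \<alpha> * f x + \<beta> * g x) = \<alpha> * L w f + \<beta> * L w g" for w \<alpha> f \<beta> g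
    unfolding L_def divdiffs_lin ..
  have L_cong: "L w f = L w g" if "w \<in> carrier W" "\<And>x. x \<in> carrier W \<Longrightarrow> f x = g x" for w f g
    unfolding L_def using aw(1)[OF that(1)] that(2) by (intro divdiffs_cong) auto
  have L_off: "L w f = 0" if f: "invariant f" and w: "w \<in> carrier W" "w \<notin> reps" for w f
  proof -
    obtain v s where vs: "s \<in> J" "a w = v @ [s]" using aJ[OF w] by blast
    have "divdiffs v (divdiff s f) \<one> = divdiffs v (\<lambda>x. 0) \<one>"
      by (rule divdiffs_cong) (use aw(1)[OF w(1)] vs f in \<open>auto simp: divdiff_def invariant_def\<close>)
    then show ?thesis by (simp add: L_def vs divdiffs_zero)
  qed
  have L_support: "len y < len w \<or> y = w"
    if "w \<in> carrier W" "y \<in> carrier W" "L w (delta y) \<noteq> 0" for w y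
    using divdiffs_delta_support[of "a w" \<one> y] aw[of w] that by (simp add: L_def)
  have L_top: "L w (delta w) \<noteq> 0" if "w \<in> carrier W" for w
    using divdiffs_delta_top[of "a w" \<one>] aw[of w] that by (simp add: L_def)
  have L_ind: "L u (coset_ind w) = (\<Sum>y\<in>carrier W. coset_ind w y * L u (delta y))"
    if "u \<in> carrier W" for u w
    unfolding L_def by (rule divdiffs_expand) (use aw[of u] that in auto)
  \<comment> \<open>The coset of \<open>w \<in> X\<^sub>J\<close> contains no element shorter than \<open>w\<close>, so \<open>L\<^sub>u\<close> sees its indicator function only if \<open>l(w) < l(u)\<close> or \<open>w = u\<close>.\<close>
  have solve: "\<exists>c. \<forall>u\<in>reps. (\<Sum>v\<in>reps. L u (coset_ind v) * c v) = b u" for b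
  proof (rule triangular_solve[OF finite_reps, where r = len])
    fix w assume w: "w \<in> reps"
    have wW: "w \<in> carrier W" using w reps_carrier by blast
    have "L w (coset_ind w) = (\<Sum>y\<in>carrier W. if y = w then L w (delta w) else 0)"
      unfolding L_ind[OF wW]
    proof (rule sum.cong[OF HOL.refl])
      fix y assume y: "y \<in> carrier W"
      show "coset_ind w y * L w (delta y) = (if y = w then L w (delta w) else 0)"
        using L_support[OF wW y] reps_minimal[OF w y] coset_eq_refl[OF wW]
        by (cases "L w (delta y) = 0") (auto simp: coset_ind_def)
    qed
    also have "\<dots> = L w (delta w)" using fin wW by simp
    finally show "L w (coset_ind w) \<noteq> 0" using L_top[OF wW] by simp
  next
    fix u w assume u: "u \<in> reps" and w: "w \<in> reps" and nz: "L u (coset_ind w) \<noteq> 0"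
    have uW: "u \<in> carrier W" using u reps_carrier by blast
    obtain y where y: "y \<in> carrier W" "coset_ind w y * L u (delta y) \<noteq> 0"
      using nz unfolding L_ind[OF uW] by (meson sum.neutral)
    then have wy: "coset_eq w y" "L u (delta y) \<noteq> 0" by (auto simp: coset_ind_def split: if_splits)
    from L_support[OF uW y(1) wy(2)] show "w = u \<or> len w < len u"
      using reps_minimal[OF w y(1) wy(1)] reps_unique[OF w u] wy(1) by auto
  qed
  have "\<forall>w. \<exists>c. \<forall>u\<in>reps. (\<Sum>v\<in>reps. L u (coset_ind v) * c v) = (if u = w then 1 else 0)"
    by (intro allI solve)
  then obtain c where c: "\<And>w u. u \<in> reps \<Longrightarrow>
      (\<Sum>v\<in>reps. L u (coset_ind v) * c w v) = (if u = w then 1 else 0)"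
    by metis
  \<comment> \<open>The basis of the invariant functions dual to the functionals \<open>L\<^sub>w\<close>, \<open>w \<in> X\<^sub>J\<close>.\<close>
  define F where "F w = (\<lambda>x. \<Sum>v\<in>reps. c w v * coset_ind v x)" for w
  have F_inv: "invariant (F w)" for w
    unfolding F_def by (intro invariant_sum invariant_coset_ind reps_carrier)
  have L_F: "L u (F w) = (if u = w then 1 else 0)" if "u \<in> reps" for u w
    using c[OF that, of w] unfolding F_def L_sum[OF finite_reps] by (simp add: mult.commute)
  have F_span: "f x = (\<Sum>w\<in>reps. L w f * F w x)" if f: "invariant f" and x: "x \<in> carrier W" for f x
  proof -
    define h where "h = (\<lambda>x. 1 * f x + (-1) * (\<Sum>w\<in>reps. L w f * F w x))"
    have "invariant (\<lambda>x. f x - (\<Sum>w\<in>reps. L w f * F w x))"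
      by (intro invariant_diff invariant_sum f F_inv)
    then have h_inv: "invariant h" by (simp add: h_def)
    have "L u h = 0" if u: "u \<in> carrier W" for u
    proof (cases "u \<in> reps")
      case True
      have "L u h = L u f - (\<Sum>w\<in>reps. L w f * L u (F w))"
        unfolding h_def L_lin L_sum[OF finite_reps] by simp
      also have "(\<Sum>w\<in>reps. L w f * L u (F w)) = (\<Sum>w\<in>reps. if w = u then L u f else 0)"
        by (rule sum.cong) (auto simp: L_F[OF True])
      finally show ?thesis using True finite_reps by simp
    qed (use L_off[OF h_inv u] in simp)
    then have "deg_less 0 h" by (intro deg_less_criterion[OF a]) (simp add: L_def)
    then show ?thesis using x by (simp add: deg_less_0 h_def)
  qed
  \<comment> \<open>The diagonal entries of the translation by \<open>w0\<close> in the dual basis: \<open>F\<^sub>w\<close> has degree \<open>l(w)\<close>, and \<open>L\<^sub>w\<close> kills lower degrees.\<close>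
  have L_w0: "L w (\<lambda>x. F w (w0 \<otimes> x)) = (-1) ^ len w" if w: "w \<in> reps" for w
  proof -
    have wW: "w \<in> carrier W" using w reps_carrier by blast
    have "deg_less (Suc (len w)) (F w)"
    proof (rule deg_less_criterion[OF a])
      fix u assume u: "u \<in> carrier W" "Suc (len w) \<le> len u"
      then have "u \<noteq> w" by auto
      then have "L u (F w) = 0" using L_F[of u w] L_off[OF F_inv u(1)] by (cases "u \<in> reps") auto
      then show "divdiffs (a u) (F w) \<one> = 0" by (simp add: L_def)
    qed
    then have "deg_less (len w) (\<lambda>x. 1 * F w (w0 \<otimes> x) + (- ((-1) ^ len w)) * F w x)"
      by (rule w0_on_graded_piece)
    then have "L w (\<lambda>x. 1 * F w (w0 \<otimes> x) + (- ((-1) ^ len w)) * F w x) = 0"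
      unfolding L_def by (rule deg_lessD) (use aw[OF wW] in auto)
    then show ?thesis unfolding L_lin using L_F[OF w, of w] by simp
  qed
  \<comment> \<open>Both sums below are the trace of the translation by \<open>w0\<close> on the invariant functions, first in the basis of coset indicators, then in the basis \<open>F\<close>.\<close>
  have "real (card {w \<in> reps. coset_eq w (w0 \<otimes> w)}) = (\<Sum>w\<in>{w \<in> reps. coset_eq w (w0 \<otimes> w)}. 1)"
    by simp
  also have "\<dots> = (\<Sum>v\<in>reps. coset_ind v (w0 \<otimes> v))"
    unfolding coset_ind_def by (rule sum.inter_filter[OF finite_reps])
  also have "\<dots> = (\<Sum>v\<in>reps. \<Sum>w\<in>reps. L w (coset_ind v) * F w (w0 \<otimes> v))"
    by (intro sum.cong HOL.refl F_span invariant_coset_ind) (auto dest: reps_carrier)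
  also have "\<dots> = (\<Sum>w\<in>reps. \<Sum>v\<in>reps. F w (w0 \<otimes> v) * L w (coset_ind v))"
    by (subst sum.swap) (simp add: mult.commute)
  also have "\<dots> = (\<Sum>w\<in>reps. L w (\<lambda>x. F w (w0 \<otimes> x)))"
  proof (rule sum.cong[OF HOL.refl])
    fix w assume w: "w \<in> reps"
    have "F w (w0 \<otimes> (x \<otimes> s)) = F w (w0 \<otimes> x)" if "x \<in> carrier W" "s \<in> J" for x s
    proof -
      have "F w (w0 \<otimes> x \<otimes> s) = F w (w0 \<otimes> x)" using F_inv[of w] that by (simp add: invariant_def)
      then show ?thesis using that J by (simp add: m_assoc subsetD)
    qed
    then have "invariant (\<lambda>x. F w (w0 \<otimes> x))" by (simp add: invariant_def)
    then have "L w (\<lambda>x. F w (w0 \<otimes> x)) = L w (\<lambda>x. \<Sum>v\<in>reps. F w (w0 \<otimes> v) * coset_ind v x)"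
      using w reps_carrier by (intro L_cong invariant_expand) auto
    then show "(\<Sum>v\<in>reps. F w (w0 \<otimes> v) * L w (coset_ind v)) = L w (\<lambda>x. F w (w0 \<otimes> x))"
      using L_sum[OF finite_reps, of w "\<lambda>v. F w (w0 \<otimes> v)" coset_ind] by simp
  qed
  also have "\<dots> = (\<Sum>w\<in>reps. (-1) ^ len w)"
    by (intro sum.cong HOL.refl L_w0)
  finally show ?thesis by simp
qed

corollary sum_signs_left_coset_reps:
  "(\<Sum>w\<in>reps. (-1 :: int) ^ len w) = int (card {w \<in> reps.
      (longest_element W S \<otimes> w) <#\<^bsub>W\<^esub> generate W J = w <#\<^bsub>W\<^esub> generate W J})"
proof -
  have "{w \<in> reps. (w0 \<otimes> w) <#\<^bsub>W\<^esub> generate W J = w <#\<^bsub>W\<^esub> generate W J} =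
      {w \<in> reps. coset_eq w (w0 \<otimes> w)}"
    by (intro Collect_cong conj_cong HOL.refl coset_eq_iff) (auto dest: reps_carrier)
  moreover have "real_of_int (\<Sum>w\<in>reps. (-1) ^ len w) =
      real_of_int (int (card {w \<in> reps. coset_eq w (w0 \<otimes> w)}))"
    using sum_signs_eq_fixed_cosets by simp
  ultimately show ?thesis unfolding w0_def by (simp only: of_int_eq_iff)
qed

end

end

theorem theorem1p1:
  fixes W :: "('a, 'b) monoid_scheme" and S J :: "'a set"
  assumes "finite_coxeter_system W S"
    and "J \<subseteq> S"
  shows "(\<Sum>w\<in>left_coset_reps W S J. (-1 :: int) ^ cox_length W S w) =
    int (card {w \<in> left_coset_reps W S J.
      (longest_element W S \<otimes>\<^bsub>W\<^esub> w) <#\<^bsub>W\<^esub> generate W J = w <#\<^bsub>W\<^esub> generate W J})"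
proof -
  from assms(1) have "coxeter_system W S" and fin: "finite (carrier W)"
    by (simp_all add: finite_coxeter_system_def)
  then obtain m where W: "group W" "S \<subseteq> carrier W" "generate W S = carrier W"
    "coxeter_matrix S m" "\<forall>u\<in>lists S. \<forall>v\<in>lists S.
      word_prod W u = word_prod W v \<longleftrightarrow> coxeter_equiv S m u v"
    unfolding coxeter_system_def by blast
  have "finite_coxeter W S m"
    by (intro finite_coxeter.intro finite_coxeter_axioms.intro) (use W fin in simp_all)
  then show ?thesis by (rule finite_coxeter.sum_signs_left_coset_reps[OF _ assms(2)])
qed

end
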